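(* Let $d,N\ge 1$ be integers, $p\in(1,\infty)$, $\bar g\in G^N(\mathbb{R}^d)$, and let $f:G^N(\mathbb{R}^d)\times G^N(\mathbb{R}^d)\to\mathbb{R}$ be a non-negative continuous function such that $f(\bar g,\bar g)=0$ and $f(g,\bar g)>0$ whenever $g\neq\bar g$. Let $c>0$ and $A_c=\{a\in L^p([0,1],\mathbb{R}^d): \|a\|_{L^p}\le c\}$. For $\gamma>0$ define $\mathcal{F}_\gamma:A_c\to[0,\infty)$ by $$\mathcal{F}_\gamma(a)=\|a\|_{L^p}^p+\gamma f(\xi_a(1),\bar g),$$ where $\xi_a$ is the curve of signatures driven by the control $a$. Then: (1) for every $\gamma>0$, $\mathcal{F}_\gamma$ admits a minimizer on $A_c$; (2) as $\gamma\to\infty$, the family $(\mathcal{F}_\gamma)_{\gamma>0}$ $\Gamma$-converges on $A_c$, with respect to the weak topology of $L^p$, to the functional $$\mathcal{F}(a)=\begin{cases}\|a\|_{L^p}^p, & \text{if } \xi_a(1)=\bar g,\\ \infty, & \text{otherwise.}\end{cases}$$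
   Context: Truncated tensor space: $T^N(\mathbb{R}^d)=\bigoplus_{k=0}^N(\mathbb{R}^d)^{\otimes k}$ with its Euclidean norm and the truncated tensor product $(g\otimes h)^k=\sum_{i=0}^k g^i\otimes h^{k-i}$ for $0\le k\le N$ (terms of order $>N$ are dropped). Vectors of $\mathbb{R}^d$, in particular the canonical basis $e_1,\dots,e_d$, are viewed as elements of the level $k=1$. Signature: for an absolutely continuous path $x:[0,1]\to\mathbb{R}^d$ with $x(0)=0$, $S_N(x)_{0,t}=\big(1,\int_{0\le u\le t}dx_u,\dots,\int_{0\le u_1\le\dots\le u_N\le t}dx_{u_1}\otimes\dots\otimes dx_{u_N}\big)\in T^N(\mathbb{R}^d)$. The space of signatures is $G^N(\mathbb{R}^d)=\{S_N(x)_{0,1}: x\in H^1([0,1],\mathbb{R}^d),\,x(0)=0\}\subset T^N(\mathbb{R}^d)$ (with the topology induced by $T^N(\mathbb{R}^d)$); it is the same set if $H^1$ paths are replaced by continuous paths of bounded variation. Control system: for $a\in L^p([0,1],\mathbb{R}^d)$, $\xi_a:[0,1]\to G^N(\mathbb{R}^d)$ is the unique absolutely continuous solution of $\dot\xi(s)=\sum_{i=1}^d a_i(s)\,U_i(\xi(s))$ for a.e. $s\in[0,1]$, $\xi(0)=(1,0,\dots,0)$, where $U_i(\xi)=\xi\otimes e_i$. (Equivalently, $\xi_a(t)=S_N(x)_{0,t}$ with $x(t)=\int_0^t a(s)\,ds$.) $\|a\|_{L^p}^p=\int_0^1|a(t)|_2^p\,dt$, with $|\cdot|_2$ the Euclidean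 norm on $\mathbb{R}^d$. $\Gamma$-convergence on $A_c$ with respect to the weak topology of $L^p$ as $\gamma\to\infty$ means: (liminf) for every family $(a_\gamma)_{\gamma>0}\subset A_c$ with $a_\gamma\rightharpoonup a$ weakly in $L^p$ as $\gamma\to\infty$, $\liminf_{\gamma\to\infty}\mathcal{F}_\gamma(a_\gamma)\ge\mathcal{F}(a)$; (limsup) for every $a\in A_c$ there exists a family $(a_\gamma)_{\gamma>0}\subset A_c$ with $a_\gamma\rightharpoonup a$ weakly in $L^p$ as $\gamma\to\infty$ and $\limsup_{\gamma\to\infty}\mathcal{F}_\gamma(a_\gamma)\le\mathcal{F}(a)$. *)

theory Defs
  imports "HOL-Analysis.Analysis"
begin

section \<open>The truncated tensor space\<close>

text \<open>
  Dimensions are carried by index types: \<open>d = CARD('d)\<close>, so that \<open>\<real>\<^sup>d\<close> is \<open>real ^ 'd\<close>, and the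
  truncation order is \<open>N = CARD('n)\<close> (the elements of \<open>'n\<close> play no role).  A tensor of level \<open>k\<close>
  is given by its coordinates in the basis \<open>e\<^sub>i\<^sub>1 \<otimes> \<dots> \<otimes> e\<^sub>i\<^sub>k\<close>, indexed by the words of length \<open>k\<close>.
  Hence the direct sum of the levels \<open>0, \<dots>, N\<close> is the Euclidean space indexed by the words of
  length at most \<open>N\<close>, with the library's Euclidean norm and topology.
\<close>

typedef ('d, 'n) tword = "{w :: 'd list. length w \<le> CARD('n)}"
  morphisms letters tword
  by (rule exI[of _ "[]"]) simp

instance tword :: (finite, type) finite
proof
  have "finite {w :: 'a list. set w \<subseteq> UNIV \<and> length w \<le> CARD('b)}"
    by (rule finite_lists_length_le) simp
  then have "finite (tword ` {w :: 'a list. length w \<le> CARD('b)} :: ('a, 'b) tword set)"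
    by simp
  then show "finite (UNIV :: ('a, 'b) tword set)"
    by (simp add: type_definition.Abs_image[OF type_definition_tword])
qed

type_synonym ('d, 'n) trunc_tensor = "real ^ ('d, 'n) tword"

text \<open>
  The coordinate of \<open>(g \<otimes> h)\<^sup>m = \<Sum>\<^sub>k g\<^sup>k \<otimes> h\<^sup>m\<^sup>-\<^sup>k\<close> at a word of length \<open>m\<close>.
\<close>
definition tensor_mult ::
  "('d::finite, 'n::finite) trunc_tensor \<Rightarrow> ('d, 'n) trunc_tensor \<Rightarrow> ('d, 'n) trunc_tensor" where
  "tensor_mult g h = (\<chi> w. \<Sum>k\<le>length (letters w).
      g $ tword (take k (letters w)) * h $ tword (drop k (letters w)))"

definition tensor_one :: "('d::finite, 'n::finite) trunc_tensor" where
  "tensor_one = (\<chi> w. if letters w = [] then 1 else 0)"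

text \<open>The embedding of \<open>\<real>\<^sup>d\<close> as level 1.\<close>
definition tensor_vec :: "real ^ 'd \<Rightarrow> ('d::finite, 'n::finite) trunc_tensor" where
  "tensor_vec v = (\<chi> w. case letters w of [i] \<Rightarrow> v $ i | _ \<Rightarrow> 0)"

definition U_field ::
  "'d \<Rightarrow> ('d::finite, 'n::finite) trunc_tensor \<Rightarrow> ('d, 'n) trunc_tensor" where
  "U_field i \<xi> = tensor_mult \<xi> (tensor_vec (axis i 1))"


section \<open>Function spaces on the unit interval\<close>

text \<open>
  Only the values on \<open>[0,1]\<close> of a function on \<open>real\<close> matter below.  The elements of \<open>L\<^sup>p\<close> are
  represented by functions; two representatives that agree a.e. are not identified.
\<close>

definition Lp_space :: "real \<Rightarrow> (real \<Rightarrow> 'b::euclidean_space) set" where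
  "Lp_space p = {a. a \<in> borel_measurable (lebesgue_on {0..1}) \<and>
      integrable (lebesgue_on {0..1}) (\<lambda>t. norm (a t) powr p)}"

definition Lp_norm :: "real \<Rightarrow> (real \<Rightarrow> 'b::euclidean_space) \<Rightarrow> real" where
  "Lp_norm p a = (LINT t|lebesgue_on {0..1}. norm (a t) powr p) powr (1 / p)"

text \<open>
  Continuous linear functionals on \<open>L\<^sup>p\<close>; boundedness forces \<open>\<phi>\<close> to agree on functions that are
  equal a.e.
\<close>
definition Lp_dual :: "real \<Rightarrow> ((real \<Rightarrow> 'b::euclidean_space) \<Rightarrow> real) set" where
  "Lp_dual p = {\<phi>.
      (\<forall>a\<in>Lp_space p. \<forall>b\<in>Lp_space p. \<phi> (\<lambda>t. a t + b t) = \<phi> a + \<phi> b) \<and>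
      (\<forall>r. \<forall>a\<in>Lp_space p. \<phi> (\<lambda>t. r *\<^sub>R a t) = r * \<phi> a) \<and>
      (\<exists>C. \<forall>a\<in>Lp_space p. \<bar>\<phi> a\<bar> \<le> C * Lp_norm p a)}"

definition Lp_weak_tendsto ::
  "real \<Rightarrow> ('i \<Rightarrow> real \<Rightarrow> 'b::euclidean_space) \<Rightarrow> (real \<Rightarrow> 'b) \<Rightarrow> 'i filter \<Rightarrow> bool" where
  "Lp_weak_tendsto p fam a F \<longleftrightarrow> (\<forall>\<phi>\<in>Lp_dual p. ((\<lambda>\<gamma>. \<phi> (fam \<gamma>)) \<longlongrightarrow> \<phi> a) F)"

text \<open>
  The \<open>\<epsilon>\<close>-\<open>\<delta>\<close> definition, \<open>D\<close> being a finite set of non-overlapping compact intervals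
  \<open>K = [Inf K, Sup K]\<close>.
\<close>
definition abs_continuous_on :: "real set \<Rightarrow> (real \<Rightarrow> 'b::real_normed_vector) \<Rightarrow> bool" where
  "abs_continuous_on S x \<longleftrightarrow> (\<forall>\<epsilon>>0. \<exists>\<delta>>0. \<forall>D T.
      D division_of T \<longrightarrow> T \<subseteq> S \<longrightarrow> (\<Sum>K\<in>D. Sup K - Inf K) < \<delta> \<longrightarrow>
      (\<Sum>K\<in>D. norm (x (Sup K) - x (Inf K))) < \<epsilon>)"

definition H1_space :: "(real \<Rightarrow> 'b::euclidean_space) set" where
  "H1_space = {x. abs_continuous_on {0..1} x \<and> (\<lambda>t. vector_derivative x (at t)) \<in> Lp_space 2}"


section \<open>Signatures\<close>

text \<open>
  For an absolutely continuous \<open>x\<close> we have \<open>dx\<^sub>u = x'(u) du\<close>.  The head of the list belongs to the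
  outermost variable, so \<open>iterated_integral x [i\<^sub>k, \<dots>, i\<^sub>1] t\<close> is the integral of
  \<open>dx\<^sup>i\<^sup>1\<^sub>u\<^sub>1 \<dots> dx\<^sup>i\<^sup>k\<^sub>u\<^sub>k\<close> over \<open>0 \<le> u\<^sub>1 \<le> \<dots> \<le> u\<^sub>k \<le> t\<close>; this is why words are reversed
  in \<open>signature\<close>.
\<close>
primrec iterated_integral :: "(real \<Rightarrow> real ^ 'd) \<Rightarrow> 'd list \<Rightarrow> real \<Rightarrow> real" where
  "iterated_integral x [] t = 1"
| "iterated_integral x (i # w) t =
     (LINT u|lebesgue_on {0..t}. iterated_integral x w u * (vector_derivative x (at u) $ i))"

definition signature :: "(real \<Rightarrow> real ^ 'd) \<Rightarrow> real \<Rightarrow> ('d::finite, 'n::finite) trunc_tensor" where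
  "signature x t = (\<chi> w. iterated_integral x (rev (letters w)) t)"

definition signature_space :: "('d::finite, 'n::finite) trunc_tensor set" where
  "signature_space = {signature x 1 | x. x \<in> H1_space \<and> x 0 = 0}"

definition is_signature_curve ::
  "(real \<Rightarrow> real ^ 'd) \<Rightarrow> (real \<Rightarrow> ('d::finite, 'n::finite) trunc_tensor) \<Rightarrow> bool" where
  "is_signature_curve a \<xi> \<longleftrightarrow>
     \<xi> ` {0..1} \<subseteq> signature_space \<and>
     abs_continuous_on {0..1} \<xi> \<and>
     \<xi> 0 = tensor_one \<and>
     (AE s in lebesgue_on {0..1}.
        (\<xi> has_vector_derivative (\<Sum>i\<in>UNIV. (a s $ i) *\<^sub>R U_field i (\<xi> s))) (at s within {0..1}))"

text \<open>
  The solution is unique only as a function on \<open>[0,1]\<close>; hence \<open>SOME\<close> instead of \<open>THE\<close>.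
\<close>
definition signature_curve ::
  "(real \<Rightarrow> real ^ 'd) \<Rightarrow> real \<Rightarrow> ('d::finite, 'n::finite) trunc_tensor" where
  "signature_curve a = (SOME \<xi>. is_signature_curve a \<xi>)"


section \<open>The functionals\<close>

definition control_ball :: "real \<Rightarrow> real \<Rightarrow> (real \<Rightarrow> real ^ 'd::finite) set" where
  "control_ball p c = {a \<in> Lp_space p. Lp_norm p a \<le> c}"

definition penalized_energy ::
  "real \<Rightarrow> (('d::finite, 'n::finite) trunc_tensor \<times> ('d, 'n) trunc_tensor \<Rightarrow> real) \<Rightarrow>
   ('d, 'n) trunc_tensor \<Rightarrow> real \<Rightarrow> (real \<Rightarrow> real ^ 'd) \<Rightarrow> real" where
  "penalized_energy p f gbar \<gamma> a = Lp_norm p a powr p + \<gamma> * f (signature_curve a 1, gbar)"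

definition constrained_energy ::
  "real \<Rightarrow> ('d::finite, 'n::finite) trunc_tensor \<Rightarrow> (real \<Rightarrow> real ^ 'd) \<Rightarrow> ereal" where
  "constrained_energy p gbar a =
     (if signature_curve a 1 = gbar then ereal (Lp_norm p a powr p) else \<infinity>)"

text \<open>
  \<open>\<Gamma>\<close>-convergence on \<open>A\<close>, as the positive real parameter tends to infinity, with respect to a
  notion of convergence \<open>tends fam a\<close> of families (with the parameter tending to infinity).
\<close>
definition Gamma_converges_on ::
  "'x set \<Rightarrow> ((real \<Rightarrow> 'x) \<Rightarrow> 'x \<Rightarrow> bool) \<Rightarrow> (real \<Rightarrow> 'x \<Rightarrow> ereal) \<Rightarrow> ('x \<Rightarrow> ereal) \<Rightarrow> bool" where
  "Gamma_converges_on A tends F Flim \<longleftrightarrow>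
     (\<forall>a\<in>A. \<forall>fam. (\<forall>\<gamma>>0. fam \<gamma> \<in> A) \<longrightarrow> tends fam a \<longrightarrow>
        Liminf at_top (\<lambda>\<gamma>. F \<gamma> (fam \<gamma>)) \<ge> Flim a) \<and>
     (\<forall>a\<in>A. \<exists>fam. (\<forall>\<gamma>>0. fam \<gamma> \<in> A) \<and> tends fam a \<and>
        Limsup at_top (\<lambda>\<gamma>. F \<gamma> (fam \<gamma>)) \<le> Flim a)"

end

theory Submission
  imports Defs
begin

text \<open>
  Read coordinate by coordinate, the control system is triangular: the coordinate at a word is the
  integral of the coordinate at the shorter word times one component of the control. Hence the
  solution is the unique family of iterated integrals of the control, and after a change of time that
  makes the control bounded it is seen to stay in the signature space.

  Along weakly convergent \<open>L\<^sup>p\<close>-bounded controls the iterated integrals converge uniformly, by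
  induction on the word: they are equicontinuous because \<open>|a| \<le> \<lambda> + \<lambda>\<^sup>1\<^sup>-\<^sup>p |a|\<^sup>p\<close> for all \<open>\<lambda> > 0\<close>, which
  is where \<open>p > 1\<close> enters. So the penalty is weakly continuous, the \<open>L\<^sup>p\<close> norm is weakly lower
  semicontinuous by convexity, and the ball is weakly compact; this gives the minimizers. For the
  lower bound in the \<open>\<Gamma>\<close>-limit, the penalty blows up along controls whose weak limit misses the target;
  constant families are recovery families.
\<close>

section \<open>Absolutely continuous functions\<close>

text \<open>The definition of \<open>signature_curve\<close> by \<open>SOME\<close> says nothing
  until a solution is known to exist inside \<open>signature_space\<close> and to be unique among
  absolutely continuous curves whose derivative is prescribed only almost everywhere. This is why
  indefinite Lebesgue integrals have to be differentiated, and why an absolutely continuous function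
  with zero derivative has to be shown constant. Compactness comes from a product over an
  uncountable index set, where a cluster point need not be the limit of a subsequence. Convergence
  statements are therefore made for arbitrary filters: a refinement of \<open>sequentially\<close>
  for the minimizers, \<open>at_top\<close> on the reals for the \<Gamma>-limit. The compactness
  argument yields convergence against bounded test functions, whereas the lower bound assumes
  convergence against the whole dual; \<open>bounded_weak_tendsto\<close> is the common
  ground.\<close>

lemma integrable_lebesgue_on_subset:
  fixes f :: "'a::euclidean_space \<Rightarrow> 'b::euclidean_space"
  assumes "integrable (lebesgue_on T) f" "S \<subseteq> T" "S \<in> sets lebesgue" "T \<in> sets lebesgue"
  shows "integrable (lebesgue_on S) f"
proof -
  have "set_integrable lebesgue T f"
    using assms(1,4) by (simp add: set_integrable_def integrable_restrict_space)
  then have "set_integrable lebesgue S f"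
    using assms by (intro set_integrable_subset[of lebesgue T f S]) auto
  then show ?thesis
    using assms(3) by (simp add: set_integrable_def integrable_restrict_space)
qed

text \<open>Lebesgue differentiation over the intervals \<open>{x..x + k}\<close> controls right
  difference quotients. The left ones are the right ones of the reflected function
  \<open>\<lambda>x. h (- x)\<close>, so the exceptional sets of both are collected.\<close>

lemma AE_indefinite_integral_derivative:
  fixes g :: "real \<Rightarrow> 'b::euclidean_space"
  assumes g: "integrable (lebesgue_on {0..1}) g"
  shows "AE s in lebesgue_on {0..1}. ((\<lambda>t. integral {0..t} g) has_vector_derivative g s) (at s)"
proof -
  define h where "h x = (if x \<in> {0..1} then g x else 0)" for x
  have "integrable lebesgue h"
    unfolding h_def using g by (subst Lebesgue_Measure.integrable_restrict_UNIV) auto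
  then have hi: "h integrable_on UNIV" by (rule integrable_on_lebesgue)
  then have hI: "h integrable_on {a..b}" for a b
    by (rule integrable_on_subcbox[where a=a and b=b, simplified]) auto
  have hJ: "(\<lambda>x. h (- x)) integrable_on {a..b}" for a b
    using hI[of "-b" "-a"] Henstock_Kurzweil_Integration.integrable_reflect_real[where f=h and a="-b" and b="-a"]
    by (simp only: minus_minus)
  obtain N1 where N1: "negligible N1" "\<And>x e. \<lbrakk>x \<notin> N1; 0 < e\<rbrakk> \<Longrightarrow>
      \<exists>d>0. \<forall>k. 0 < k \<and> k < d \<longrightarrow> norm (integral {x..x + k} h /\<^sub>R k - h x) < e"
    using integrable_ccontinuous_explicit[of h] hI by auto
  obtain N2 where N2: "negligible N2" "\<And>x e. \<lbrakk>x \<notin> N2; 0 < e\<rbrakk> \<Longrightarrow>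
      \<exists>d>0. \<forall>k. 0 < k \<and> k < d \<longrightarrow> norm (integral {x..x + k} (\<lambda>x. h (- x)) /\<^sub>R k - h (- x)) < e"
    using integrable_ccontinuous_explicit[of "\<lambda>x. h (- x)"] hJ by auto
  \<comment> \<open>The endpoints are discarded as well: the claim is about the two-sided
    derivative, which needs room on both sides of \<open>s\<close>.\<close>
  define N where "N = N1 \<union> uminus ` N2 \<union> {0, 1}"
  have N: "negligible N"
    unfolding N_def using N1(1) N2(1) by (auto intro!: negligible_differentiable_image_negligible derivative_intros simp: differentiable_on_def)
  have *: "((\<lambda>t. integral {0..t} g) has_vector_derivative g s) (at s)" if s: "s \<in> {0..1}" "s \<notin> N" for s
    unfolding has_vector_derivative_def has_derivative_at_alt
  proof (intro conjI allI impI)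
    show "bounded_linear (\<lambda>x. x *\<^sub>R g s)" by (rule bounded_linear_scaleR_left)
    fix e :: real assume "e > 0"
    have sx: "s \<notin> N1" "- s \<notin> N2" "0 < s" "s < 1"
      using s by (auto simp: N_def image_iff)
    obtain d1 where d1: "d1 > 0" "\<And>k. 0 < k \<Longrightarrow> k < d1 \<Longrightarrow> norm (integral {s..s + k} h /\<^sub>R k - h s) < e"
      using N1(2)[OF sx(1) \<open>e > 0\<close>] by auto
    obtain d2 where d2: "d2 > 0" "\<And>k. 0 < k \<Longrightarrow> k < d2 \<Longrightarrow>
        norm (integral {- s..- s + k} (\<lambda>x. h (- x)) /\<^sub>R k - h s) < e"
      using N2(2)[OF sx(2) \<open>e > 0\<close>] by auto
    have hs: "h s = g s" using s by (simp add: h_def)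
    have eq: "integral {0..y} g = integral {0..y} h" if "y \<le> 1" for y
      using that by (intro integral_cong) (auto simp: h_def)
    have scale: "norm (A - k *\<^sub>R v) \<le> e * k" if "0 < k" "norm (A /\<^sub>R k - v) < e" for A v :: 'b and k
    proof -
      have "A - k *\<^sub>R v = k *\<^sub>R (A /\<^sub>R k - v)"
        using that(1) by (simp add: algebra_simps)
      then have "norm (A - k *\<^sub>R v) = k * norm (A /\<^sub>R k - v)"
        using that(1) by simp
      then show ?thesis using that by (simp add: mult.commute)
    qed
    show "\<exists>d>0. \<forall>y. norm (y - s) < d \<longrightarrow>
        norm (integral {0..y} g - integral {0..s} g - (y - s) *\<^sub>R g s) \<le> e * norm (y - s)"
    proof (intro exI conjI allI impI)
      show "min (min d1 d2) (min s (1 - s)) > 0" using d1 d2 sx by auto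
      fix y assume y: "norm (y - s) < min (min d1 d2) (min s (1 - s))"
      consider "y = s" | "y > s" | "y < s" by linarith
      then show "norm (integral {0..y} g - integral {0..s} g - (y - s) *\<^sub>R g s) \<le> e * norm (y - s)"
      proof cases
        case 2
        have "integral {0..s} h + integral {s..y} h = integral {0..y} h"
          using 2 sx hI by (intro Henstock_Kurzweil_Integration.integral_combine) auto
        then have "integral {0..y} g - integral {0..s} g = integral {s..s + (y - s)} h"
          using eq[of s] eq[of y] y sx by (auto simp: algebra_simps abs_if split: if_splits)
        then show ?thesis
          using scale[OF _ d1(2)[of "y - s"]] y 2 hs by auto
      next
        case 3
        have "integral {0..y} h + integral {y..s} h = integral {0..s} h"
          using 3 sx y hI by (intro Henstock_Kurzweil_Integration.integral_combine) auto
        moreover have "integral {y..s} h = integral {- s..- s + (s - y)} (\<lambda>x. h (- x))"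
          using integral_reflect_real[of s y h] by simp
        moreover have "integral {0..y} g = integral {0..y} h" "integral {0..s} g = integral {0..s} h"
          using sx 3 by (auto intro: eq)
        ultimately have "integral {0..y} g - integral {0..s} g
            = - integral {- s..- s + (s - y)} (\<lambda>x. h (- x))"
          by (metis add_diff_cancel_left' minus_diff_eq)
        then have *: "integral {0..y} g - integral {0..s} g - (y - s) *\<^sub>R g s
            = - (integral {- s..- s + (s - y)} (\<lambda>x. h (- x)) - (s - y) *\<^sub>R h s)"
          using hs by (simp add: scaleR_diff_left)
        show ?thesis
          unfolding * norm_minus_cancel
          using scale[OF _ d2(2)[of "s - y"]] y 3 by auto
      qed simp
    qed
  qed
  show ?thesis
  proof (rule AE_I')
    show "N \<inter> {0..1} \<in> null_sets (lebesgue_on {0..1})"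
      using N by (simp add: null_sets_restrict_space negligible_iff_null_sets null_set_Int2)
  qed (use * in auto)
qed

text \<open>\<open>norm (g x)\<close> is at most \<open>n\<close> plus its excess over
  \<open>n\<close>. Dominated convergence makes the integral of the excess small for a suitable
  \<open>n\<close>, and the bounded part contributes at most \<open>n\<close> times the measure of
  \<open>E\<close>.\<close>

lemma integral_norm_uniformly_small:
  fixes g :: "real \<Rightarrow> 'b::euclidean_space"
  assumes g: "integrable M g" and M: "finite_measure M" and "e > 0"
  obtains d where "d > 0"
    "\<And>E. E \<in> sets M \<Longrightarrow> measure M E < d \<Longrightarrow> (LINT x|M. indicator E x * norm (g x)) < e"
proof -
  interpret finite_measure M by fact
  have [measurable]: "g \<in> borel_measurable M" using g by simp
  have "(\<lambda>n. LINT x|M. max 0 (norm (g x) - real n)) \<longlonglongrightarrow> (LINT x|M. 0)"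
  proof (rule integral_dominated_convergence[where w="\<lambda>x. norm (g x)"])
    show "AE x in M. (\<lambda>n. max 0 (norm (g x) - real n)) \<longlonglongrightarrow> 0"
    proof (intro AE_I2 tendsto_eventually)
      fix x
      show "\<forall>\<^sub>F n in sequentially. max 0 (norm (g x) - real n) = 0"
        using eventually_ge_at_top[of "nat \<lceil>norm (g x)\<rceil>"]
        by eventually_elim linarith
    qed
  qed (use g in auto)
  then have "\<forall>\<^sub>F n in sequentially. (LINT x|M. max 0 (norm (g x) - real n)) < e / 2"
    by (rule order_tendstoD) (use \<open>e > 0\<close> in auto)
  then obtain n where n: "(LINT x|M. max 0 (norm (g x) - real n)) < e / 2"
    by (auto simp: eventually_sequentially)
  show thesis
  proof
    \<comment> \<open>\<open>n + 1\<close> instead of \<open>n\<close> keeps the threshold positive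
      when \<open>n = 0\<close>.\<close>
    show "e / (2 * (real n + 1)) > 0" using \<open>e > 0\<close> by simp
    fix E assume E: "E \<in> sets M" "measure M E < e / (2 * (real n + 1))"
    have i1: "integrable M (\<lambda>x. max 0 (norm (g x) - real n))"
      by (rule Bochner_Integration.integrable_bound[OF integrable_norm[OF g]]) auto
    have i2: "integrable M (\<lambda>x. real n * indicator E x)"
      using E by (intro integrable_mult_right integrable_real_indicator) (auto simp: emeasure_finite top.not_eq_extremum[symmetric])
    have "(LINT x|M. indicator E x * norm (g x))
        \<le> (LINT x|M. real n * indicator E x + max 0 (norm (g x) - real n))"
    proof (rule integral_mono)
      show "integrable M (\<lambda>x. indicator E x * norm (g x))"
        using integrable_mult_indicator[OF E(1) integrable_norm[OF g]] by simp
      show "integrable M (\<lambda>x. real n * indicator E x + max 0 (norm (g x) - real n))"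
        using i1 i2 by simp
    qed (auto simp: indicator_def)
    also have "\<dots> = real n * measure M E + (LINT x|M. max 0 (norm (g x) - real n))"
      using i1 i2 E by simp
    also have "real n * measure M E \<le> real n * (e / (2 * (real n + 1)))"
      using E by (intro mult_left_mono) auto
    also have "\<dots> \<le> e / 2"
      using \<open>e > 0\<close> by (simp add: field_simps)
    finally show "(LINT x|M. indicator E x * norm (g x)) < e"
      using n by linarith
  qed
qed

text \<open>The increments over \<open>D\<close> sum to at most the integral of
  \<open>norm (g x)\<close> over the union of \<open>D\<close>. The measure of that union is the
  total length, so uniform smallness over sets of small measure provides the
  \<open>\<delta>\<close>.\<close>

lemma abs_continuous_indefinite_integral:
  fixes g :: "real \<Rightarrow> 'b::euclidean_space"
  assumes g: "integrable (lebesgue_on {0..1}) g"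
  shows "abs_continuous_on {0..1} (\<lambda>t. integral {0..t} g)"
  unfolding abs_continuous_on_def
proof (intro allI impI)
  fix e :: real assume "e > 0"
  have "finite_measure (lebesgue_on {0..1::real})"
    by (simp add: finite_measure_lebesgue_on)
  then obtain d where d: "d > 0" "\<And>E. E \<in> sets (lebesgue_on {0..1}) \<Longrightarrow> measure (lebesgue_on {0..1}) E < d \<Longrightarrow>
      (LINT x|lebesgue_on {0..1}. indicator E x * norm (g x)) < e"
    using integral_norm_uniformly_small[OF g _ \<open>e > 0\<close>] by metis
  show "\<exists>\<delta>>0. \<forall>D T. D division_of T \<longrightarrow> T \<subseteq> {0..1} \<longrightarrow> (\<Sum>K\<in>D. Sup K - Inf K) < \<delta> \<longrightarrow>
      (\<Sum>K\<in>D. norm (integral {0..Sup K} g - integral {0..Inf K} g)) < e"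
  proof (intro exI conjI allI impI)
    fix D T assume D: "D division_of T" and T: "T \<subseteq> {0..1::real}" and small: "(\<Sum>K\<in>D. Sup K - Inf K) < d"
    have gi: "integrable (lebesgue_on S) g" if "S \<subseteq> {0..1}" "S \<in> sets lebesgue" for S
      using integrable_lebesgue_on_subset[OF g that] by simp
    have gI: "g integrable_on {a..b}" if "0 \<le> a" "b \<le> 1" for a b
      using gi[of "{a..b}"] that by (intro integrable_on_lebesgue_on) auto
    have cT: "T \<in> sets lebesgue"
      unfolding division_ofD(6)[OF D, symmetric]
      using division_ofD(1)[OF D] division_ofD(4)[OF D] by (intro sets.finite_Union) fastforce+
    have K: "\<exists>a b. K = {a..b} \<and> a \<le> b \<and> 0 \<le> a \<and> b \<le> 1" if KD: "K \<in> D" for K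
    proof -
      obtain a b where "K = {a..b}" using division_ofD(4)[OF D KD] by auto
      moreover have "K \<noteq> {}" "K \<subseteq> {0..1}"
        using division_ofD(2,3)[OF D KD] T by auto
      ultimately show ?thesis by auto
    qed
    have ng: "(\<lambda>x. norm (g x)) integrable_on T"
      using integrable_norm[OF gi[OF T cT]] cT by (intro integrable_on_lebesgue_on)
    have "(\<Sum>K\<in>D. norm (integral {0..Sup K} g - integral {0..Inf K} g)) \<le> (\<Sum>K\<in>D. integral K (\<lambda>x. norm (g x)))"
    proof (rule sum_mono)
      fix S assume "S \<in> D"
      then obtain a b where S: "S = {a..b}" "a \<le> b" "0 \<le> a" "b \<le> 1" using K by blast
      have "integral {0..a} g + integral {a..b} g = integral {0..b} g"
        using S gI by (intro Henstock_Kurzweil_Integration.integral_combine) auto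
      then have "integral {0..Sup S} g - integral {0..Inf S} g = integral {a..b} g"
        using S by (simp add: algebra_simps)
      also have "norm \<dots> \<le> integral {a..b} (\<lambda>x. norm (g x))"
        using S gi[of "{a..b}"] by (intro integral_norm_bound_integral gI) (auto intro!: integrable_on_lebesgue_on)
      finally show "norm (integral {0..Sup S} g - integral {0..Inf S} g) \<le> integral S (\<lambda>x. norm (g x))"
        using S by simp
    qed
    also have "\<dots> = integral T (\<lambda>x. norm (g x))"
      using integral_combine_division_topdown[OF ng D] by simp
    also have "\<dots> = (LINT x|lebesgue_on T. norm (g x))"
      using integrable_norm[OF gi[OF T cT]] cT by (simp add: lebesgue_integral_eq_integral)
    also have "\<dots> = (LINT x|lebesgue_on {0..1}. indicator T x * norm (g x))"
      using integral_restrict[OF T cT, of "\<lambda>x. norm (g x)"]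
      by (simp add: indicator_def if_distrib[of "\<lambda>u. u * _"] of_bool_def cong: if_cong)
    also have "\<dots> < e"
    proof (rule d(2))
      show "T \<in> sets (lebesgue_on {0..1})" using cT T by (simp add: sets_restrict_space_iff)
      have "measure (lebesgue_on {0..1}) T = measure lebesgue T"
        using cT T by (intro measure_restrict_space) auto
      also have "\<dots> = (\<Sum>K\<in>D. measure lebesgue K)"
        by (rule content_division[OF D, symmetric])
      also have "\<dots> = (\<Sum>K\<in>D. Sup K - Inf K)"
        using K by (intro sum.cong) fastforce+
      finally show "measure (lebesgue_on {0..1}) T < d" using small by simp
    qed
    finally show "(\<Sum>K\<in>D. norm (integral {0..Sup K} g - integral {0..Inf K} g)) < e" .
  qed fact
qed

text \<open>Cousin's lemma with a gauge that makes \<open>f\<close> nearly constant around the points where the derivative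
  vanishes and keeps the intervals tagged in the exceptional null set inside an open set of small
  measure, on which absolute continuity applies.\<close>
lemma abs_continuous_zero_derivative:
  fixes f :: "real \<Rightarrow> 'b::euclidean_space"
  assumes ac: "abs_continuous_on {0..1} f"
    and der: "AE s in lebesgue_on {0..1}. (f has_vector_derivative 0) (at s within {0..1})"
    and t: "t \<in> {0..1}"
  shows "f t = f 0"
proof (rule ccontr)
  assume ne: "f t \<noteq> f 0"
  \<comment> \<open>Half the distance leaves room for two errors: at most \<open>e / 2\<close> from
    the intervals tagged outside \<open>N\<close> and less than \<open>e\<close> from those tagged
    in \<open>N\<close>, together less than \<open>2 * e\<close>.\<close>
  define e where "e = norm (f t - f 0) / 2"
  have e: "e > 0" using ne by (simp add: e_def)
  obtain d where d: "d > 0" "\<And>D T. D division_of T \<Longrightarrow> T \<subseteq> {0..1} \<Longrightarrow> (\<Sum>K\<in>D. Sup K - Inf K) < d \<Longrightarrow>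
      (\<Sum>K\<in>D. norm (f (Sup K) - f (Inf K))) < e"
    using ac e unfolding abs_continuous_on_def by metis
  obtain N where N: "N \<in> null_sets (lebesgue_on {0..1})"
      "{s\<in>space (lebesgue_on {0..1}). \<not> (f has_vector_derivative 0) (at s within {0..1})} \<subseteq> N"
    using der unfolding eventually_ae_filter by auto
  have N0: "N \<in> null_sets lebesgue"
    using N(1) by (simp add: null_sets_restrict_space)
  obtain G where G: "open G" "N \<subseteq> G" "G - N \<in> lmeasurable" "emeasure lebesgue (G - N) < ennreal d"
    using sets_lebesgue_outer_open[of N d] N0 d(1) by auto
  have Gm: "emeasure lebesgue G < ennreal d"
    using G emeasure_Diff_null_set[OF N0, of G] by simp
  have "\<exists>r>0. \<forall>y\<in>{0..1}. \<bar>y - s\<bar> < r \<longrightarrow> norm (f y - f s) \<le> (e / 2) * \<bar>y - s\<bar>"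
    if "s \<in> {0..1} - N" for s
  proof -
    have "(f has_vector_derivative 0) (at s within {0..1})" using that N(2) by auto
    then show ?thesis
      unfolding has_vector_derivative_def has_derivative_within_alt using e by (metis half_gt_zero real_norm_def scaleR_zero_right diff_zero)
  qed
  then obtain r where r: "\<And>s. s \<in> {0..1} - N \<Longrightarrow> r s > 0"
      "\<And>s y. s \<in> {0..1} - N \<Longrightarrow> y \<in> {0..1} \<Longrightarrow> \<bar>y - s\<bar> < r s \<Longrightarrow> norm (f y - f s) \<le> (e / 2) * \<bar>y - s\<bar>"
    by metis
  define \<gamma> where "\<gamma> s = (if s \<in> N then G else if s \<in> {0..1} then ball s (r s) else ball s 1)" for s
  have "gauge \<gamma>"
    using G r(1) by (auto simp: gauge_def \<gamma>_def)
  then obtain p where p: "p tagged_division_of {0..t}" "\<gamma> fine p"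
    using fine_division_exists_real by blast
  note pD = tagged_division_ofD[OF p(1)]
  have K: "\<exists>a b. K = {a..b} \<and> a \<le> x \<and> x \<le> b \<and> 0 \<le> a \<and> b \<le> 1" if "(x, K) \<in> p" for x K
    using pD(2,3,4)[OF that] t by fastforce
  let ?v = "\<lambda>K. norm (f (Sup K) - f (Inf K))"
  have tel: "(\<Sum>(x, K)\<in>p. f (Sup K) - f (Inf K)) = f t - f 0"
    using additive_tagged_division_1[OF _ p(1), of f] t by simp
  have "norm (f t - f 0) \<le> (\<Sum>(x, K)\<in>p. ?v K)"
    unfolding tel[symmetric] by (rule sum_norm_le) auto
  also have "\<dots> = (\<Sum>(x, K)\<in>{z \<in> p. fst z \<in> N}. ?v K) + (\<Sum>(x, K)\<in>{z \<in> p. fst z \<notin> N}. ?v K)"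
    by (subst sum.union_disjoint[symmetric]) (use pD(1) in \<open>auto intro!: sum.cong\<close>)
  also have "(\<Sum>(x, K)\<in>{z \<in> p. fst z \<notin> N}. ?v K) \<le> (\<Sum>(x, K)\<in>{z \<in> p. fst z \<notin> N}. (e / 2) * measure lebesgue K)"
  proof (rule sum_mono, clarify)
    fix x K assume xK: "(x, K) \<in> p" "fst (x, K) \<notin> N"
    obtain a b where ab: "K = {a..b}" "a \<le> x" "x \<le> b" "0 \<le> a" "b \<le> 1" using K[OF xK(1)] by blast
    have x: "x \<in> {0..1} - N" using ab xK by auto
    have "K \<subseteq> \<gamma> x" using p(2) xK by (auto simp: fine_def)
    then have "K \<subseteq> ball x (r x)" using x by (simp add: \<gamma>_def)
    then have "a \<in> ball x (r x)" "b \<in> ball x (r x)" using ab by (auto simp del: mem_ball)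
    then have "\<bar>a - x\<bar> < r x" "\<bar>b - x\<bar> < r x" by (auto simp: dist_real_def)
    then have "norm (f a - f x) \<le> (e / 2) * \<bar>a - x\<bar>" "norm (f b - f x) \<le> (e / 2) * \<bar>b - x\<bar>"
      using r(2)[OF x, of a] r(2)[OF x, of b] ab by auto
    moreover have "norm (f b - f a) \<le> norm (f b - f x) + norm (f a - f x)"
      using norm_triangle_ineq4[of "f b - f x" "f a - f x"] by simp
    ultimately show "?v K \<le> (e / 2) * measure lebesgue K"
      using ab by (auto simp: algebra_simps)
  qed
  also have "\<dots> \<le> (\<Sum>(x, K)\<in>p. (e / 2) * measure lebesgue K)"
    using pD(1) e by (intro sum_mono2) auto
  also have "\<dots> = (e / 2) * (\<Sum>(x, K)\<in>p. measure lebesgue K)"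
    by (simp add: sum_distrib_left case_prod_unfold)
  also have "(\<Sum>(x, K)\<in>p. measure lebesgue K) = t"
    using additive_tagged_division_1[OF _ p(1), of "\<lambda>x. x"] t K
    by (subst sum.cong[OF refl, of p _ "\<lambda>(x, K). Sup K - Inf K"]) fastforce+
  also have "(e / 2) * t \<le> e / 2" using t e by (simp add: mult_left_le)
  also have "(\<Sum>(x, K)\<in>{z \<in> p. fst z \<in> N}. ?v K) < e"
  proof -
    define q where "q = {z \<in> p. fst z \<in> N}"
    have q: "q tagged_partial_division_of {0..t}" "q \<subseteq> p"
      using p(1) tagged_partial_division_subset[of p "{0..t}" q] by (auto simp: q_def tagged_division_of_def)
    have D: "(snd ` q) division_of \<Union>(snd ` q)"
      by (rule partial_division_of_tagged_division[OF q(1)])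
    have sub: "\<Union>(snd ` q) \<subseteq> {0..1}" using K q(2) by fastforce
    have subG: "\<Union>(snd ` q) \<subseteq> G"
    proof clarsimp
      fix y x K assume "(x, K) \<in> q" "y \<in> K"
      then show "y \<in> G" using p(2) by (fastforce simp: fine_def q_def \<gamma>_def)
    qed
    have "(\<Sum>K\<in>snd ` q. Sup K - Inf K) = (\<Sum>K\<in>snd ` q. measure lebesgue K)"
      using K q(2) by (intro sum.cong) fastforce+
    also have "\<dots> = measure lebesgue (\<Union>(snd ` q))"
      by (rule content_division[OF D])
    also have "\<dots> < d"
    proof -
      have "emeasure lebesgue (\<Union>(snd ` q)) < ennreal d"
        using emeasure_mono[OF subG, of lebesgue] Gm G(1) by auto
      then show ?thesis
        unfolding measure_def by (subst enn2real_less_iff) (auto intro: order.strict_trans[OF _ ennreal_less_top])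
    qed
    finally have "(\<Sum>K\<in>snd ` q. ?v K) < e"
      using d(2)[OF D sub] by simp
    moreover have "(\<Sum>(x, K)\<in>q. ?v K) = (\<Sum>K\<in>snd ` q. ?v K)"
    proof -
      \<comment> \<open>Distinct tags may carry the same degenerate interval, so passing from tagged
        to untagged sums needs a summand that is zero on every interval with empty interior.
        \<open>?v\<close> is zero on points, but \<open>Sup\<close> and \<open>Inf\<close> of the
        empty set carry no information; \<open>?w\<close> repairs this.\<close>
      let ?w = "\<lambda>K. if K = {} then 0 else ?v K"
      have "(\<Sum>(x, K)\<in>q. ?w K) = (\<Sum>K\<in>snd ` q. ?w K)"
        by (rule sum.over_tagged_division_lemma[OF tagged_partial_division_of_Union_self[OF q(1)]])
           (auto simp: not_less box_real)
      moreover have "(\<Sum>(x, K)\<in>q. ?w K) = (\<Sum>(x, K)\<in>q. ?v K)" "(\<Sum>K\<in>snd ` q. ?w K) = (\<Sum>K\<in>snd ` q. ?v K)"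
        using K q(2) by (intro sum.cong; fastforce)+
      ultimately show ?thesis by simp
    qed
    ultimately show ?thesis by (simp add: q_def)
  qed
  finally show False using e by (simp add: e_def)
qed

lemma AE_lebesgue_on_subset:
  assumes "AE x in lebesgue_on T. P x" "S \<subseteq> T" "S \<in> sets lebesgue" "T \<in> sets lebesgue"
  shows "AE x in lebesgue_on S. P x"
  using assms by (auto simp: AE_restrict_space_iff elim!: eventually_mono)

text \<open>The form with two functions serves both for a coordinate of the difference of two
  solutions and, with a constant \<open>g\<close>, for a curve that differs from an indefinite
  integral by a constant.\<close>

lemma abs_continuous_on_dominated:
  assumes f: "abs_continuous_on S f" and g: "abs_continuous_on S g"
    and le: "\<And>x y. x \<in> S \<Longrightarrow> y \<in> S \<Longrightarrow> norm (h y - h x) \<le> norm (f y - f x) + norm (g y - g x)"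
  shows "abs_continuous_on S h"
  unfolding abs_continuous_on_def
proof (intro allI impI)
  fix e :: real assume "e > 0"
  then have e2: "e / 2 > 0" by simp
  obtain d1 where d1: "d1 > 0" "\<And>D T. D division_of T \<Longrightarrow> T \<subseteq> S \<Longrightarrow> (\<Sum>K\<in>D. Sup K - Inf K) < d1 \<Longrightarrow>
      (\<Sum>K\<in>D. norm (f (Sup K) - f (Inf K))) < e / 2"
    using f e2 unfolding abs_continuous_on_def by metis
  obtain d2 where d2: "d2 > 0" "\<And>D T. D division_of T \<Longrightarrow> T \<subseteq> S \<Longrightarrow> (\<Sum>K\<in>D. Sup K - Inf K) < d2 \<Longrightarrow>
      (\<Sum>K\<in>D. norm (g (Sup K) - g (Inf K))) < e / 2"
    using g e2 unfolding abs_continuous_on_def by metis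
  show "\<exists>\<delta>>0. \<forall>D T. D division_of T \<longrightarrow> T \<subseteq> S \<longrightarrow> (\<Sum>K\<in>D. Sup K - Inf K) < \<delta> \<longrightarrow>
      (\<Sum>K\<in>D. norm (h (Sup K) - h (Inf K))) < e"
  proof (intro exI conjI allI impI)
    show "min d1 d2 > 0" using d1(1) d2(1) by simp
    fix D T assume D: "D division_of T" "T \<subseteq> S" "(\<Sum>K\<in>D. Sup K - Inf K) < min d1 d2"
    have "(\<Sum>K\<in>D. norm (h (Sup K) - h (Inf K)))
        \<le> (\<Sum>K\<in>D. norm (f (Sup K) - f (Inf K)) + norm (g (Sup K) - g (Inf K)))"
    proof (intro sum_mono le)
      fix K assume K: "K \<in> D"
      obtain a b where "K = {a..b}" using division_ofD(4)[OF D(1) K] by auto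
      moreover have "K \<noteq> {}" "K \<subseteq> S" using division_ofD(2,3)[OF D(1) K] D(2) by auto
      ultimately show "Sup K \<in> S" "Inf K \<in> S" by auto
    qed
    also have "\<dots> < e / 2 + e / 2"
      using d1(2)[OF D(1,2)] d2(2)[OF D(1,2)] D(3) by (simp add: sum.distrib)
    finally show "(\<Sum>K\<in>D. norm (h (Sup K) - h (Inf K))) < e" by simp
  qed
qed

lemma abs_continuous_on_const: "abs_continuous_on S (\<lambda>x. c)"
  unfolding abs_continuous_on_def by (auto intro: exI[of _ 1])

lemma integrable_continuous_mult:
  fixes g :: "real \<Rightarrow> real"
  assumes h: "continuous_on {0..1} h" and g: "integrable (lebesgue_on {0..1}) g"
  shows "integrable (lebesgue_on {0..1}) (\<lambda>u. h u * g u)"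
proof -
  have "bounded (h ` {0..1})"
    by (rule compact_imp_bounded[OF compact_continuous_image[OF h compact_Icc]])
  then obtain B where B: "\<And>x. x \<in> {0..1} \<Longrightarrow> \<bar>h x\<bar> \<le> B"
    unfolding bounded_iff by (metis imageI real_norm_def)
  have [measurable]: "h \<in> borel_measurable (lebesgue_on {0..1})"
    by (rule continuous_imp_measurable_on_sets_lebesgue[OF h]) auto
  show ?thesis
  proof (rule Bochner_Integration.integrable_bound)
    show "integrable (lebesgue_on {0..1}) (\<lambda>x. B * g x)" using g by simp
    show "(\<lambda>u. h u * g u) \<in> borel_measurable (lebesgue_on {0..1})" using g by measurable
    show "AE x in lebesgue_on {0..1}. norm (h x * g x) \<le> norm (B * g x)"
    proof (rule AE_I2)
      fix x assume "x \<in> space (lebesgue_on {0..1::real})"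
      then have "\<bar>h x\<bar> \<le> \<bar>B\<bar>" using B[of x] by auto
      then show "norm (h x * g x) \<le> norm (B * g x)" by (simp add: abs_mult mult_right_mono)
    qed
  qed
qed

lemma integrable_vec_nth:
  "integrable M a \<Longrightarrow> integrable M (\<lambda>u. (a u :: real ^ 'd) $ i)"
  by (rule integrable_bounded_linear[OF bounded_linear_vec_nth])

lemma integrable_vecI:
  fixes f :: "'a \<Rightarrow> real ^ 'w::finite"
  assumes "\<And>w. integrable M (\<lambda>x. f x $ w)"
  shows "integrable M f"
proof -
  have "integrable M (\<lambda>x. \<Sum>w\<in>UNIV. (f x $ w) *\<^sub>R (axis w 1 :: real ^ 'w))"
    by (intro Bochner_Integration.integrable_sum integrable_scaleR_left assms)
  moreover have "(\<Sum>w\<in>UNIV. (v $ w) *\<^sub>R axis w 1) = v" for v :: "real ^ 'w"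
    by (simp add: vec_eq_iff axis_def if_distrib cong: if_cong)
  ultimately show ?thesis by simp
qed

section \<open>Iterated integrals driven by a control\<close>

text \<open>The path driven by \<open>a\<close> has a derivative that agrees with \<open>a\<close>
  only almost everywhere. Integrating against the control itself avoids the path and makes sense for
  every integrable control.\<close>

primrec word_integral :: "(real \<Rightarrow> real ^ 'd) \<Rightarrow> 'd list \<Rightarrow> real \<Rightarrow> real" where
  "word_integral a [] t = 1"
| "word_integral a (i # w) t = (LINT u|lebesgue_on {0..t}. word_integral a w u * (a u $ i))"

lemma iterated_integral_eq_word_integral:
  "iterated_integral x w t = word_integral (\<lambda>u. vector_derivative x (at u)) w t"
  by (induction w arbitrary: t) simp_all

text \<open>The three facts depend on each other along the word: continuity for \<open>w\<close>
  makes the next integrand integrable, integrability turns the Lebesgue integral into the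
  \<open>integral\<close> of \<open>word_integral_Cons\<close>, and such a primitive is again
  continuous.\<close>

lemma
  fixes a :: "real \<Rightarrow> real ^ 'd::finite"
  assumes a: "integrable (lebesgue_on {0..1}) a"
  shows continuous_on_word_integral: "continuous_on {0..1} (word_integral a w)"
    and integrable_word_integral: "integrable (lebesgue_on {0..1}) (\<lambda>u. word_integral a w u * (a u $ i))"
    and word_integral_Cons: "t \<le> 1 \<Longrightarrow>
        word_integral a (i # w) t = integral {0..t} (\<lambda>u. word_integral a w u * (a u $ i))"
proof -
  have int: "integrable (lebesgue_on {0..1}) (\<lambda>u. word_integral a w u * (a u $ i))"
    if "continuous_on {0..1} (word_integral a w)" for w i
    by (rule integrable_continuous_mult[OF that integrable_vec_nth[OF a]])
  have cons: "word_integral a (i # w) t = integral {0..t} (\<lambda>u. word_integral a w u * (a u $ i))"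
    if "continuous_on {0..1} (word_integral a w)" "t \<le> 1" for w i t
    using that integrable_lebesgue_on_subset[OF int[OF that(1)], of "{0..t}"]
    by (simp add: lebesgue_integral_eq_integral)
  have cont: "continuous_on {0..1} (word_integral a w)" for w
  proof (induction w)
    case (Cons i w)
    have "continuous_on {0..1} (\<lambda>t. integral {0..t} (\<lambda>u. word_integral a w u * (a u $ i)))"
      by (intro indefinite_integral_continuous_1 integrable_on_lebesgue_on int Cons) auto
    then show ?case
      by (rule continuous_on_eq) (simp only: cons[OF Cons] atLeastAtMost_iff)
  qed (simp add: continuous_on_const[of _ 1])
  show "continuous_on {0..1} (word_integral a w)" by (rule cont)
  show "integrable (lebesgue_on {0..1}) (\<lambda>u. word_integral a w u * (a u $ i))"
    by (rule int[OF cont])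
  show "t \<le> 1 \<Longrightarrow> word_integral a (i # w) t = integral {0..t} (\<lambda>u. word_integral a w u * (a u $ i))"
    by (rule cons[OF cont])
qed

lemma word_integral_cong_AE:
  fixes a b :: "real \<Rightarrow> real ^ 'd::finite"
  assumes a: "integrable (lebesgue_on {0..1}) a" and b: "integrable (lebesgue_on {0..1}) b"
    and eq: "AE s in lebesgue_on {0..1}. a s = b s"
  shows "t \<le> 1 \<Longrightarrow> word_integral a w t = word_integral b w t"
proof (induction w arbitrary: t)
  case (Cons i w)
  have AE: "AE s in lebesgue_on {0..t}. a s = b s"
    using AE_lebesgue_on_subset[OF eq, of "{0..t}"] Cons.prems by auto
  show ?case
    unfolding word_integral.simps
  proof (rule integral_cong_AE)
    show "(\<lambda>u. word_integral a w u * (a u $ i)) \<in> borel_measurable (lebesgue_on {0..t})"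
      using integrable_lebesgue_on_subset[OF integrable_word_integral[OF a], of "{0..t}"] Cons.prems by auto
    show "(\<lambda>u. word_integral b w u * (b u $ i)) \<in> borel_measurable (lebesgue_on {0..t})"
      using integrable_lebesgue_on_subset[OF integrable_word_integral[OF b], of "{0..t}"] Cons.prems by auto
    show "AE x in lebesgue_on {0..t}. word_integral a w x * (a x $ i) = word_integral b w x * (b x $ i)"
      by (rule lebesgue_on_mono[OF AE]) (use Cons in auto)
  qed
qed simp

text \<open>Membership in \<open>signature_space\<close> concerns time 1 only. A control switched
  off after \<open>T\<close> freezes its iterated integrals at their values at \<open>T\<close>,
  which reduces intermediate times to time 1.\<close>

lemma word_integral_restrict:
  fixes a :: "real \<Rightarrow> real ^ 'd::finite"
  assumes T: "T \<in> {0..1}"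
  shows "word_integral (\<lambda>u. if u \<in> {0..T} then a u else 0) w 1 = word_integral a w T"
proof -
  define a' where "a' = (\<lambda>u. if u \<in> {0..T} then a u else 0)"
  have *: "word_integral a' w t = word_integral a w t" if "t \<le> T" for t w
    using that
  proof (induction w arbitrary: t)
    case (Cons i w)
    show ?case
      unfolding word_integral.simps
      by (rule Bochner_Integration.integral_cong) (use Cons in \<open>auto simp: a'_def\<close>)
  qed simp
  have "word_integral a' w 1 = word_integral a w T"
  proof (cases w)
    case (Cons i v)
    have "word_integral a' w 1 =
        (LINT u|lebesgue_on {0..1}. (if u \<in> {0..T} then word_integral a' v u * (a u $ i) else 0))"
      unfolding Cons word_integral.simps by (intro Bochner_Integration.integral_cong) (auto simp: a'_def)
    also have "\<dots> = (LINT u|lebesgue_on {0..T}. word_integral a' v u * (a u $ i))"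
      using T by (intro integral_restrict) auto
    also have "\<dots> = word_integral a w T"
      unfolding Cons word_integral.simps by (intro Bochner_Integration.integral_cong) (auto simp: *)
    finally show ?thesis .
  qed simp
  then show ?thesis by (simp only: a'_def)
qed

section \<open>Coordinates of tensors and of the control system\<close>

lemma letters_tword: "length w \<le> CARD('n) \<Longrightarrow> letters (tword w :: ('d, 'n::finite) tword) = w"
  by (simp add: tword_inverse)

lemma length_letters: "length (letters (w :: ('d, 'n::finite) tword)) \<le> CARD('n)"
  using letters[of w] by simp

text \<open>A factor that lives in level 1 kills every splitting of the word except the one that
  cuts off its last letter.\<close>

lemma U_field_nth:
  fixes \<xi> :: "('d::finite, 'n::finite) trunc_tensor"
  shows "U_field i \<xi> $ w =
    (if letters w \<noteq> [] \<and> last (letters w) = i then \<xi> $ tword (butlast (letters w)) else 0)"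
proof (cases "letters w" rule: rev_cases)
  case Nil
  then show ?thesis
    by (simp add: U_field_def tensor_mult_def tensor_vec_def letters_tword)
next
  case (snoc v j)
  have len: "length v + 1 \<le> CARD('n)"
    using length_letters[of w] snoc by simp
  have level1: "tensor_vec (axis i 1) $ (tword (drop k (letters w)) :: ('d, 'n) tword)
      = (if k = length v \<and> j = i then 1 else 0)" if "k \<le> length v + 1" for k
  proof (cases "k \<le> length v")
    case True
    then have "drop k (letters w) = drop k v @ [j]" using snoc by simp
    moreover have "length (drop k v) + 1 \<le> CARD('n)" using len by simp
    ultimately show ?thesis
      using True by (cases "drop k v") (auto simp: tensor_vec_def letters_tword axis_def split: list.splits)
  next
    case False
    then show ?thesis
      using that snoc by (simp add: tensor_vec_def letters_tword)
  qed
  have "U_field i \<xi> $ w = (\<Sum>k\<le>length v + 1. if k = length v then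
      (if j = i then \<xi> $ tword (take k (letters w)) else 0) else 0)"
    unfolding U_field_def tensor_mult_def vec_lambda_beta
  proof (rule sum.cong)
    fix k assume "k \<in> {..length v + 1}"
    then show "\<xi> $ tword (take k (letters w)) * tensor_vec (axis i 1) $ (tword (drop k (letters w)) :: ('d, 'n) tword) =
        (if k = length v then (if j = i then \<xi> $ tword (take k (letters w)) else 0) else 0)"
      by (subst level1) auto
  qed (simp add: snoc)
  also have "\<dots> = (if j = i then \<xi> $ tword v else 0)"
    using snoc by simp
  finally show ?thesis using snoc by simp
qed

lemma velocity_nth:
  fixes \<xi> :: "('d::finite, 'n::finite) trunc_tensor"
  shows "(\<Sum>i\<in>UNIV. (v $ i) *\<^sub>R U_field i \<xi>) $ w =
    (if letters w = [] then 0 else \<xi> $ tword (butlast (letters w)) * v $ last (letters w))"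
proof -
  have "(\<Sum>i\<in>UNIV. (v $ i) *\<^sub>R U_field i \<xi>) $ w = (\<Sum>i\<in>UNIV. v $ i * U_field i \<xi> $ w)"
    by simp
  also have "\<dots> = (\<Sum>i\<in>UNIV. if i = last (letters w) then
      (if letters w = [] then 0 else \<xi> $ tword (butlast (letters w)) * v $ last (letters w)) else 0)"
    by (intro sum.cong) (auto simp: U_field_nth)
  finally show ?thesis by simp
qed

definition word_integrals :: "(real \<Rightarrow> real ^ 'd) \<Rightarrow> real \<Rightarrow> ('d::finite, 'n::finite) trunc_tensor" where
  "word_integrals a t = (\<chi> w. word_integral a (rev (letters w)) t)"

lemma word_integrals_tword:
  "length v \<le> CARD('n) \<Longrightarrow>
    (word_integrals a t :: ('d::finite, 'n::finite) trunc_tensor) $ tword v = word_integral a (rev v) t"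
  by (simp add: word_integrals_def letters_tword)

lemma velocity_word_integrals_nth:
  "(\<Sum>i\<in>UNIV. (a s $ i) *\<^sub>R U_field i (word_integrals a s :: ('d::finite, 'n::finite) trunc_tensor)) $ w =
    (case rev (letters w) of [] \<Rightarrow> 0 | i # v \<Rightarrow> word_integral a v s * (a s $ i))"
proof (cases "letters w" rule: rev_cases)
  case (snoc v j)
  then show ?thesis
    using length_letters[of w] unfolding velocity_nth by (simp add: word_integrals_tword)
qed (unfold velocity_nth, simp)

lemma
  fixes a :: "real \<Rightarrow> real ^ 'd::finite"
  assumes a: "integrable (lebesgue_on {0..1}) a"
  shows word_integrals_solution: "t \<in> {0..1} \<Longrightarrow> (word_integrals a t :: ('d, 'n::finite) trunc_tensor) =
      tensor_one + integral {0..t} (\<lambda>s. \<Sum>i\<in>UNIV. (a s $ i) *\<^sub>R U_field i (word_integrals a s))"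
    and integrable_velocity: "integrable (lebesgue_on {0..1})
      (\<lambda>s. \<Sum>i\<in>UNIV. (a s $ i) *\<^sub>R U_field i (word_integrals a s :: ('d, 'n) trunc_tensor))"
proof -
  let ?G = "\<lambda>s. \<Sum>i\<in>UNIV. (a s $ i) *\<^sub>R U_field i (word_integrals a s :: ('d, 'n) trunc_tensor)"
  show int: "integrable (lebesgue_on {0..1}) ?G"
  proof (rule integrable_vecI)
    fix w :: "('d, 'n) tword"
    show "integrable (lebesgue_on {0..1}) (\<lambda>s. ?G s $ w)"
      unfolding velocity_word_integrals_nth
      using integrable_word_integral[OF a] by (cases "rev (letters w)") auto
  qed
  show "(word_integrals a t :: ('d, 'n) trunc_tensor) = tensor_one + integral {0..t} ?G" if t: "t \<in> {0..1}"
  proof (rule vec_eq_iff[THEN iffD2, rule_format])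
    fix w :: "('d, 'n) tword"
    have "?G integrable_on {0..t}"
      using t by (intro integrable_on_lebesgue_on integrable_lebesgue_on_subset[OF int]) auto
    then have "integral {0..t} ?G $ w = integral {0..t} (\<lambda>s. ?G s $ w)"
      by (rule integral_component_eq_cart[symmetric])
    also have "\<dots> = (case rev (letters w) of [] \<Rightarrow> 0 | i # v \<Rightarrow> integral {0..t} (\<lambda>s. word_integral a v s * (a s $ i)))"
      unfolding velocity_word_integrals_nth by (simp split: list.split)
    also have "\<dots> = (case rev (letters w) of [] \<Rightarrow> 0 | i # v \<Rightarrow> word_integral a (i # v) t)"
      using t word_integral_Cons[OF a] by (auto split: list.split)
    finally show "word_integrals a t $ w = (tensor_one + integral {0..t} ?G) $ w"
      by (simp add: word_integrals_def tensor_one_def split: list.split)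
  qed
qed

lemma word_integrals_abs_continuous:
  fixes a :: "real \<Rightarrow> real ^ 'd::finite"
  assumes a: "integrable (lebesgue_on {0..1}) a"
  shows "abs_continuous_on {0..1} (word_integrals a :: real \<Rightarrow> ('d, 'n::finite) trunc_tensor)"
proof (rule abs_continuous_on_dominated)
  let ?G = "\<lambda>s. \<Sum>i\<in>UNIV. (a s $ i) *\<^sub>R U_field i (word_integrals a s :: ('d, 'n) trunc_tensor)"
  show "abs_continuous_on {0..1} (\<lambda>t. integral {0..t} ?G)"
    by (rule abs_continuous_indefinite_integral[OF integrable_velocity[OF a]])
  show "abs_continuous_on {0..1} (\<lambda>t. 0 :: real)" by (rule abs_continuous_on_const)
  fix x y :: real assume "x \<in> {0..1}" "y \<in> {0..1}"
  then show "norm (word_integrals a y - word_integrals a x :: ('d, 'n) trunc_tensor)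
      \<le> norm (integral {0..y} ?G - integral {0..x} ?G) + norm (0 - 0 :: real)"
    using word_integrals_solution[OF a, where 'n='n, of x] word_integrals_solution[OF a, where 'n='n, of y] by simp
qed

lemma word_integrals_derivative:
  fixes a :: "real \<Rightarrow> real ^ 'd::finite"
  assumes a: "integrable (lebesgue_on {0..1}) a"
  shows "AE s in lebesgue_on {0..1}. ((word_integrals a :: real \<Rightarrow> ('d, 'n::finite) trunc_tensor) has_vector_derivative
    (\<Sum>i\<in>UNIV. (a s $ i) *\<^sub>R U_field i (word_integrals a s))) (at s within {0..1})"
proof (rule lebesgue_on_mono[OF AE_indefinite_integral_derivative[OF integrable_velocity[OF a]]])
  let ?G = "\<lambda>s. \<Sum>i\<in>UNIV. (a s $ i) *\<^sub>R U_field i (word_integrals a s :: ('d, 'n) trunc_tensor)"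
  fix s :: real
  assume d: "((\<lambda>t. integral {0..t} ?G) has_vector_derivative ?G s) (at s)" and s: "s \<in> {0..1}"
  have "((\<lambda>t. tensor_one + integral {0..t} ?G) has_vector_derivative 0 + ?G s) (at s within {0..1})"
    by (rule has_vector_derivative_add[OF has_vector_derivative_const has_vector_derivative_at_within[OF d]])
  then have "((\<lambda>t. tensor_one + integral {0..t} ?G) has_vector_derivative ?G s) (at s within {0..1})"
    unfolding add_0 .
  then show "(word_integrals a has_vector_derivative ?G s) (at s within {0..1})"
    by (rule has_vector_derivative_transform[OF s, rotated]) (rule word_integrals_solution[OF a])
qed

text \<open>Induction on the length of the word takes the place of a Gronwall estimate. Once the
  shorter words agree, the difference of the two coordinates has derivative zero almost everywhere,
  and absolute continuity turns this into constancy.\<close>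

lemma is_signature_curve_unique:
  fixes \<xi> \<eta> :: "real \<Rightarrow> ('d::finite, 'n::finite) trunc_tensor"
  assumes "is_signature_curve a \<xi>" "is_signature_curve a \<eta>" "t \<in> {0..1}"
  shows "\<xi> t = \<eta> t"
proof -
  let ?V = "\<lambda>\<xi> s. \<Sum>i\<in>UNIV. (a s $ i) *\<^sub>R U_field i (\<xi> s :: ('d, 'n) trunc_tensor)"
  have ac: "abs_continuous_on {0..1} \<xi>" "abs_continuous_on {0..1} \<eta>"
    and z: "\<xi> 0 = tensor_one" "\<eta> 0 = tensor_one"
    and der: "AE s in lebesgue_on {0..1}. (\<xi> has_vector_derivative ?V \<xi> s) (at s within {0..1})"
      "AE s in lebesgue_on {0..1}. (\<eta> has_vector_derivative ?V \<eta> s) (at s within {0..1})"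
    using assms unfolding is_signature_curve_def by auto
  have "\<xi> t $ w = \<eta> t $ w" if "t \<in> {0..1}" for w t
    using that
  proof (induction "length (letters w)" arbitrary: w t rule: less_induct)
    case less
    let ?f = "\<lambda>s. \<xi> s $ w - \<eta> s $ w"
    have "?f t = ?f 0"
    proof (rule abs_continuous_zero_derivative[OF _ _ less.prems])
      show "abs_continuous_on {0..1} ?f"
      proof (rule abs_continuous_on_dominated[OF ac])
        fix x y :: real
        have "?f y - ?f x = (\<xi> y - \<xi> x) $ w - (\<eta> y - \<eta> x) $ w" by simp
        then show "norm (?f y - ?f x) \<le> norm (\<xi> y - \<xi> x) + norm (\<eta> y - \<eta> x)"
          using component_le_norm_cart[of "\<xi> y - \<xi> x" w] component_le_norm_cart[of "\<eta> y - \<eta> x" w]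
          by (simp only: real_norm_def)
      qed
      have "AE s in lebesgue_on {0..1}. (\<xi> has_vector_derivative ?V \<xi> s) (at s within {0..1}) \<and>
          (\<eta> has_vector_derivative ?V \<eta> s) (at s within {0..1})"
        using der by eventually_elim simp
      then show "AE s in lebesgue_on {0..1}. (?f has_vector_derivative 0) (at s within {0..1})"
      proof (rule lebesgue_on_mono)
        fix s :: real
        assume d: "(\<xi> has_vector_derivative ?V \<xi> s) (at s within {0..1}) \<and>
          (\<eta> has_vector_derivative ?V \<eta> s) (at s within {0..1})" and s: "s \<in> {0..1}"
        have "?V \<xi> s $ w = ?V \<eta> s $ w"
        proof (cases "letters w = []")
          case False
          have "\<xi> s $ tword (butlast (letters w)) = \<eta> s $ tword (butlast (letters w))"
            using False length_letters[of w] by (intro less.hyps s) (simp add: letters_tword)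
          then show ?thesis unfolding velocity_nth by simp
        qed (unfold velocity_nth, simp)
        moreover have "((\<lambda>s. \<xi> s $ w) has_vector_derivative ?V \<xi> s $ w) (at s within {0..1})"
            "((\<lambda>s. \<eta> s $ w) has_vector_derivative ?V \<eta> s $ w) (at s within {0..1})"
          using d by (blast intro: bounded_linear.has_vector_derivative[OF bounded_linear_vec_nth])+
        ultimately show "(?f has_vector_derivative 0) (at s within {0..1})"
          using has_vector_derivative_diff[of "\<lambda>s. \<xi> s $ w" "?V \<xi> s $ w" _ "\<lambda>s. \<eta> s $ w" "?V \<eta> s $ w"]
          by (simp only: diff_self)
      qed
    qed
    then show ?case by (simp add: z)
  qed
  then show ?thesis using assms(3) by (simp add: vec_eq_iff)
qed

section \<open>Reparametrization of controls\<close>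

text \<open>The primitive of \<open>b\<close> is the required path. \<open>H1_space\<close> speaks
  of its \<open>vector_derivative\<close>, whose value is arbitrary where the primitive is not
  differentiable; as that set is null, completeness of Lebesgue measure still makes it
  measurable.\<close>

lemma signature_path_in_signature_space:
  fixes b :: "real \<Rightarrow> real ^ 'd::finite"
  assumes b: "b \<in> borel_measurable (lebesgue_on {0..1})" and bd: "\<And>s. norm (b s) \<le> B"
  shows "(word_integrals b 1 :: ('d, 'n::finite) trunc_tensor) \<in> signature_space"
proof -
  interpret finite_measure "lebesgue_on {0..1::real}"
    by (simp add: finite_measure_lebesgue_on)
  have bi: "integrable (lebesgue_on {0..1}) b"
    using bd by (intro integrable_const_bound[of _ B] b) auto
  define x where "x t = integral {0..t} b" for t
  let ?v = "\<lambda>t. vector_derivative x (at t)"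
  have v: "AE s in lebesgue_on {0..1}. b s = ?v s"
    using AE_indefinite_integral_derivative[OF bi] unfolding x_def[symmetric]
    by eventually_elim (simp add: vector_derivative_at)
  have vm: "?v \<in> borel_measurable (lebesgue_on {0..1})"
  proof -
    have "(\<lambda>s. if s \<in> {0..1} then ?v s else 0) \<in> borel_measurable lebesgue"
    proof (rule borel_measurable_AE)
      show "(\<lambda>s. if s \<in> {0..1} then b s else 0) \<in> borel_measurable lebesgue"
        by (rule borel_measurable_if_I[OF b]) auto
      show "AE s in lebesgue. (if s \<in> {0..1} then b s else 0) = (if s \<in> {0..1} then ?v s else 0)"
        using v by (auto simp: AE_restrict_space_iff elim!: eventually_mono)
    qed
    then show ?thesis by (rule borel_measurable_if_D)
  qed
  have vi: "integrable (lebesgue_on {0..1}) ?v"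
    using bi vm v by (subst integrable_cong_AE[of _ _ b]) (auto elim: eventually_mono)
  have "(\<lambda>t. norm (?v t) powr 2) \<in> borel_measurable (lebesgue_on {0..1})"
    using vm by measurable
  moreover have "AE t in lebesgue_on {0..1}. norm (norm (?v t) powr 2) \<le> B powr 2"
    using v by eventually_elim (metis bd norm_ge_zero powr_mono2 powr_ge_zero real_norm_def abs_of_nonneg zero_le_numeral)
  ultimately have "integrable (lebesgue_on {0..1}) (\<lambda>t. norm (?v t) powr 2)"
    by (intro integrable_const_bound) auto
  then have "x \<in> H1_space"
    using abs_continuous_indefinite_integral[OF bi] vm
    by (simp add: H1_space_def Lp_space_def x_def[abs_def])
  moreover have "x 0 = 0" by (simp add: x_def)
  moreover have "signature x 1 = (word_integrals b 1 :: ('d, 'n) trunc_tensor)"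
    unfolding signature_def word_integrals_def iterated_integral_eq_word_integral
    using word_integral_cong_AE[OF bi vi v] by simp
  ultimately show ?thesis unfolding signature_space_def by (intro CollectI exI[of _ x]) simp
qed

text \<open>Composition with a change of time can destroy Lebesgue measurability but not Borel
  measurability, so a control is replaced by a Borel version before time is changed. Vanishing
  outside \<open>S\<close> allows integration over the whole line.\<close>

lemma lebesgue_on_vec_AE_borel:
  fixes a :: "real \<Rightarrow> real ^ 'd::finite"
  assumes a: "a \<in> borel_measurable (lebesgue_on S)" and S: "S \<in> sets borel"
  obtains a' where "a' \<in> borel_measurable borel" "AE s in lebesgue_on S. a s = a' s"
    "\<And>s. s \<notin> S \<Longrightarrow> a' s = 0"
proof -
  have S': "S \<in> sets lebesgue" using S by simp
  have "\<forall>i. \<exists>g\<in>borel_measurable lborel. AE s in lborel. (if s \<in> S then a s else 0) $ i = g s"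
  proof
    fix i
    have "(\<lambda>s. (if s \<in> S then a s else 0)) \<in> borel_measurable lebesgue"
      by (rule borel_measurable_if_I[OF a S'])
    then have "(\<lambda>s. (if s \<in> S then a s else 0) $ i) \<in> borel_measurable lebesgue"
      by (rule measurable_compose) (intro borel_measurable_continuous_onI continuous_intros)
    then show "\<exists>g\<in>borel_measurable lborel. AE s in lborel. (if s \<in> S then a s else 0) $ i = g s"
      by (rule completion_ex_borel_measurable_real)
  qed
  then obtain g where "\<forall>i. g i \<in> borel_measurable lborel \<and> (AE s in lborel. (if s \<in> S then a s else 0) $ i = g i s)"
    unfolding Bex_def choice_iff by blast
  then have g: "\<And>i. g i \<in> borel_measurable lborel"
      "\<And>i. AE s in lborel. (if s \<in> S then a s else 0) $ i = g i s"
    by blast+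
  define a' where "a' s = (if s \<in> S then \<Sum>i\<in>UNIV. g i s *\<^sub>R (axis i 1 :: real ^ 'd) else 0)" for s
  show thesis
  proof
    show "a' \<in> borel_measurable borel"
      unfolding a'_def using g(1) S by measurable
    have "AE s in lborel. \<forall>i. (if s \<in> S then a s else 0) $ i = g i s"
      using g(2) by (simp add: AE_all_countable)
    then have "AE s in lebesgue. \<forall>i. (if s \<in> S then a s else 0) $ i = g i s"
      by (rule AE_completion)
    then have "AE s in lebesgue. s \<in> S \<longrightarrow> a s = a' s"
      by eventually_elim (auto simp: a'_def vec_eq_iff axis_def if_distrib cong: if_cong)
    then show "AE s in lebesgue_on S. a s = a' s"
      using S' by (simp add: AE_restrict_space_iff)
    show "a' s = 0" if "s \<notin> S" for s using that by (simp add: a'_def)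
  qed
qed

lemma integral_lebesgue_on_eq_lborel:
  fixes f :: "real \<Rightarrow> real"
  assumes "(\<lambda>u. indicator S u * f u) \<in> borel_measurable borel" "S \<in> sets borel"
  shows "(LINT u|lebesgue_on S. f u) = (LINT u|lborel. indicator S u * f u)"
  using assms by (simp add: integral_restrict_space integral_completion)

text \<open>Change of variables for the primitive \<open>\<sigma>\<close> of \<open>\<rho>\<close>,
  phrased as a push-forward of measures. It is checked on open intervals, whose preimages under an
  increasing bijection of the line are again open intervals.\<close>

lemma distr_density_primitive_eq_lborel:
  fixes \<rho> \<sigma> :: "real \<Rightarrow> real"
  assumes \<rho>: "\<rho> \<in> borel_measurable borel" "\<And>u. 0 \<le> \<rho> u"
    and \<sigma>: "bij \<sigma>" "strict_mono \<sigma>"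
    and prim: "\<And>x y. x \<le> y \<Longrightarrow> integrable lborel (\<lambda>u. indicator {x<..<y} u * \<rho> u) \<and>
        (LINT u|lborel. indicator {x<..<y} u * \<rho> u) = \<sigma> y - \<sigma> x"
  shows "distr (density lborel \<rho>) borel \<sigma> = lborel"
proof (rule lborel_eqI[symmetric])
  have [measurable]: "\<sigma> \<in> borel_measurable borel"
    using \<sigma>(2) by (intro borel_measurable_mono strict_mono_mono)
  have [measurable]: "\<rho> \<in> borel_measurable borel" by (rule \<rho>(1))
  fix l u :: real
  assume "\<And>b. b \<in> Basis \<Longrightarrow> l \<bullet> b \<le> u \<bullet> b"
  then have lu: "l \<le> u" by simp
  obtain x y where xy: "\<sigma> x = l" "\<sigma> y = u" using bij_is_surj[OF \<sigma>(1)] by (metis surjD)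
  have le: "x \<le> y" using lu xy strict_mono_less_eq[OF \<sigma>(2)] by metis
  have vim: "\<sigma> -` {l<..<u} = {x<..<y}"
    using xy strict_mono_less[OF \<sigma>(2)] by auto
  have "emeasure (distr (density lborel \<rho>) borel \<sigma>) (box l u) = emeasure (density lborel \<rho>) {x<..<y}"
    by (subst emeasure_distr) (simp_all add: vim)
  also have "\<dots> = (\<integral>\<^sup>+u. ennreal (indicator {x<..<y} u * \<rho> u) \<partial>lborel)"
    by (subst emeasure_density) (auto intro!: nn_integral_cong simp: indicator_def)
  also have "\<dots> = ennreal (\<sigma> y - \<sigma> x)"
    using prim[OF le] \<rho>(2) by (subst nn_integral_eq_integral) auto
  finally show "emeasure (distr (density lborel \<rho>) borel \<sigma>) (box l u) = (\<Prod>b\<in>Basis. (u - l) \<bullet> b)"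
    using xy by simp
qed simp

text \<open>\<open>L\<close> is the integral of \<open>1 + h\<close> over \<open>{0..1}\<close>, so
  the normalized primitive fixes 0 and 1. Outside \<open>{0..1}\<close> its slope is the constant
  \<open>1 / L\<close>; hence it maps onto the whole line, as the push-forward argument
  requires.\<close>

lemma strict_mono_primitive:
  fixes h :: "real \<Rightarrow> real"
  assumes h: "integrable lborel h" "\<And>u. 0 \<le> h u" "\<And>u. u \<notin> {0..1} \<Longrightarrow> h u = 0"
    and L: "L = 1 + (LINT u|lborel. h u)"
  obtains \<sigma> where "bij \<sigma>" "strict_mono \<sigma>" "\<sigma> 0 = 0" "\<sigma> 1 = 1"
    "\<And>x y. x \<le> y \<Longrightarrow> integrable lborel (\<lambda>u. indicator {x<..<y} u * ((1 + h u) / L)) \<and>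
        (LINT u|lborel. indicator {x<..<y} u * ((1 + h u) / L)) = \<sigma> y - \<sigma> x"
proof -
  have Lpos: "L > 0" using L h(2) by (simp add: add_pos_nonneg)
  have [measurable]: "h \<in> borel_measurable borel" using h(1) by auto
  define K where "K t = (LINT u|lborel. indicator {..t} u * h u)" for t
  have hi: "integrable lborel (\<lambda>u. indicator A u * h u)" if "A \<in> sets borel" for A
    using integrable_mult_indicator[OF _ h(1), of A] that by simp
  have K_diff: "K y - K x = (LINT u|lborel. indicator {x<..<y} u * h u)" if "x \<le> y" for x y
  proof -
    have "K y - K x = (LINT u|lborel. indicator {..y} u * h u - indicator {..x} u * h u)"
      unfolding K_def by (rule Bochner_Integration.integral_diff[symmetric]) (auto intro: hi)
    also have "\<dots> = (LINT u|lborel. indicator {x<..<y} u * h u)"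
    proof (rule integral_cong_AE)
      show "AE u in lborel. indicator {..y} u * h u - indicator {..x} u * h u = indicator {x<..<y} u * h u"
        using AE_lborel_singleton[of x] AE_lborel_singleton[of y]
        by eventually_elim (use that in \<open>auto simp: indicator_def\<close>)
    qed measurable
    finally show ?thesis .
  qed
  have K_mono: "K x \<le> K y" if "x \<le> y" for x y
    unfolding K_def using that h(2) by (intro integral_mono hi) (auto simp: indicator_def)
  have K0: "K t = 0" if "t \<le> 0" for t
  proof -
    have "K t = (LINT u::real|lborel. 0)"
      unfolding K_def
    proof (rule integral_cong_AE)
      show "AE u in lborel. indicator {..t} u * h u = 0"
        using AE_lborel_singleton[of 0] by eventually_elim (use that h(3) in \<open>auto simp: indicator_def\<close>)
    qed measurable
    then show ?thesis by simp
  qed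
  have K1: "K t = L - 1" if "t \<ge> 1" for t
  proof -
    have "K t = (LINT u|lborel. h u)"
      unfolding K_def using that h(3) by (intro Bochner_Integration.integral_cong) (auto simp: indicator_def)
    then show ?thesis using L by simp
  qed
  have K_cont: "continuous_on {0..1} K"
  proof (rule continuous_on_eq)
    have hS: "set_integrable lborel A h" if "A \<in> sets borel" for A
      using hi[OF that] by (simp add: set_integrable_def)
    show "continuous_on {0..1} (\<lambda>t. integral {0..t} h)"
      using set_borel_integral_eq_integral(1)[OF hS] by (intro indefinite_integral_continuous_1) auto
    fix t :: real assume t: "t \<in> {0..1}"
    have "integral {0..t} h = (LINT u|lborel. indicator {0..t} u * h u)"
      using set_borel_integral_eq_integral(2)[OF hS, of "{0..t}"] by (simp add: set_lebesgue_integral_def)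
    also have "\<dots> = K t"
      unfolding K_def using h(3) by (intro Bochner_Integration.integral_cong) (auto simp: indicator_def)
    finally show "integral {0..t} h = K t" .
  qed
  define \<sigma> where "\<sigma> t = (t + K t) / L" for t
  have sm: "strict_mono \<sigma>"
    unfolding \<sigma>_def using Lpos K_mono
    by (intro strict_monoI divide_strict_right_mono) (auto intro: add_less_le_mono)
  have "\<exists>x. \<sigma> x = y" for y
  proof -
    consider "y < 0" | "y \<in> {0..1}" | "y > 1" by fastforce
    then show ?thesis
    proof cases
      case 1
      then have "y * L \<le> 0" using Lpos by (simp add: mult_nonpos_nonneg)
      then show ?thesis using K0 Lpos by (intro exI[of _ "y * L"]) (simp add: \<sigma>_def)
    next
      case 2
      have "continuous_on {0..1} \<sigma>"
        unfolding \<sigma>_def using Lpos by (intro continuous_intros K_cont) auto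
      then show ?thesis
        using IVT'[of \<sigma> 0 y 1] 2 K0[of 0] K1[of 1] Lpos by (auto simp: \<sigma>_def)
    next
      case 3
      then have "1 + (y - 1) * L \<ge> 1" using Lpos by simp
      then show ?thesis using K1 Lpos by (intro exI[of _ "1 + (y - 1) * L"]) (simp add: \<sigma>_def field_simps)
    qed
  qed
  then have "bij \<sigma>"
    using strict_mono_imp_inj_on[OF sm] unfolding bij_def surj_def by metis
  moreover have "integrable lborel (\<lambda>u. indicator {x<..<y} u * ((1 + h u) / L)) \<and>
        (LINT u|lborel. indicator {x<..<y} u * ((1 + h u) / L)) = \<sigma> y - \<sigma> x" if "x \<le> y" for x y
  proof -
    have *: "indicator {x<..<y} u * ((1 + h u) / L) = (indicator {x<..<y} u + indicator {x<..<y} u * h u) / L" for u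
      by (simp add: algebra_simps add_divide_distrib)
    have i: "integrable lborel (indicator {x<..<y} :: real \<Rightarrow> real)"
      by (intro integrable_real_indicator) (auto simp: emeasure_lborel_Ioo \<open>x \<le> y\<close>)
    have ih: "integrable lborel (\<lambda>u. indicator {x<..<y} u * h u)" by (rule hi) simp
    have int: "integrable lborel (\<lambda>u. indicator {x<..<y} u + indicator {x<..<y} u * h u)"
      by (rule Bochner_Integration.integrable_add[OF i ih])
    have val: "(LINT u|lborel. indicator {x<..<y} u + indicator {x<..<y} u * h u) = (y - x) + (K y - K x)"
      using that i ih K_diff[OF that] by simp
    have "(LINT u|lborel. (indicator {x<..<y} u + indicator {x<..<y} u * h u) / L) = ((y - x) + (K y - K x)) / L"
      unfolding integral_divide_zero val ..
    moreover have "\<dots> = \<sigma> y - \<sigma> x"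
      by (simp add: \<sigma>_def diff_divide_distrib add_divide_distrib)
    moreover have "integrable lborel (\<lambda>u. (indicator {x<..<y} u + indicator {x<..<y} u * h u) / L)"
      using int by (rule integrable_divide)
    ultimately show ?thesis
      unfolding * by simp
  qed
  moreover have "\<sigma> 0 = 0" "\<sigma> 1 = 1" using K0[of 0] K1[of 1] Lpos by (auto simp: \<sigma>_def)
  ultimately show thesis using sm that by blast
qed

text \<open>Time is changed by the primitive of \<open>1 + |a|\<close> rather than of \<open>|a|\<close>, so that it is invertible even
  where \<open>a\<close> vanishes. This step is needed because for \<open>p < 2\<close> the path driven by \<open>a\<close> need not be in \<open>H\<^sup>1\<close>.\<close>
lemma bounded_reparametrization:
  fixes a :: "real \<Rightarrow> real ^ 'd::finite"
  assumes a: "integrable (lebesgue_on {0..1}) a"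
  obtains b B where "b \<in> borel_measurable (lebesgue_on {0..1})" "\<And>s. norm (b s) \<le> B"
    "\<And>w. word_integral b w 1 = word_integral a w 1"
proof -
  have am: "a \<in> borel_measurable (lebesgue_on {0..1})" using a by auto
  obtain a' where a'[measurable]: "a' \<in> borel_measurable borel" and eq: "AE s in lebesgue_on {0..1}. a s = a' s"
    and z: "\<And>s. s \<notin> {0..1} \<Longrightarrow> a' s = 0"
    using lebesgue_on_vec_AE_borel[OF am] by auto
  have a'm: "a' \<in> borel_measurable (lebesgue_on {0..1})"
    by (intro measurable_restrict_space1 measurable_completion) simp
  have a'i: "integrable (lebesgue_on {0..1}) a'"
    using a am a'm eq integrable_cong_AE by blast
  have "integrable lebesgue (\<lambda>s. if s \<in> {0..1} then a' s else 0)"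
    using a'i by (subst Lebesgue_Measure.integrable_restrict_UNIV) auto
  also have "(\<lambda>s. if s \<in> {0..1} then a' s else 0) = a'" using z by auto
  finally have a'l: "integrable lborel a'"
    by (simp add: integrable_completion)
  define L where "L = 1 + (LINT u|lborel. norm (a' u))"
  obtain \<sigma> where \<sigma>: "bij \<sigma>" "strict_mono \<sigma>" "\<sigma> 0 = 0" "\<sigma> 1 = 1"
    and prim: "\<And>x y. x \<le> y \<Longrightarrow> integrable lborel (\<lambda>u. indicator {x<..<y} u * ((1 + norm (a' u)) / L)) \<and>
        (LINT u|lborel. indicator {x<..<y} u * ((1 + norm (a' u)) / L)) = \<sigma> y - \<sigma> x"
    using strict_mono_primitive[of "\<lambda>u. norm (a' u)" L] a'l z L_def by (auto simp: integrable_norm)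
  have Lpos: "L > 0" unfolding L_def by (simp add: add_pos_nonneg)
  define \<rho> where "\<rho> u = (1 + norm (a' u)) / L" for u
  have \<rho>pos: "\<rho> u > 0" for u unfolding \<rho>_def using Lpos by (simp add: add_pos_nonneg)
  have [measurable]: "\<rho> \<in> borel_measurable borel" unfolding \<rho>_def by measurable
  have [measurable]: "\<sigma> \<in> borel_measurable borel"
    using \<sigma>(2) by (intro borel_measurable_mono strict_mono_mono)
  have push: "distr (density lborel \<rho>) borel \<sigma> = lborel"
    by (rule distr_density_primitive_eq_lborel) (use \<sigma> \<rho>pos prim in \<open>auto simp: \<rho>_def[abs_def] less_imp_le\<close>)
  define \<tau> where "\<tau> = inv \<sigma>"
  have \<tau>\<sigma>: "\<tau> (\<sigma> u) = u" and \<sigma>\<tau>: "\<sigma> (\<tau> s) = s" for u s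
    using \<sigma>(1) by (simp_all add: \<tau>_def bij_is_inj bij_is_surj surj_f_inv_f)
  have "mono \<tau>"
    by (rule monoI) (metis \<sigma>\<tau> \<sigma>(2) strict_mono_less_eq)
  then have [measurable]: "\<tau> \<in> borel_measurable borel" by (rule borel_measurable_mono)
  \<comment> \<open>Forced by the change of variables:
    \<open>\<rho> u *\<^sub>R b (\<sigma> u)\<close> must be \<open>a' u\<close>. As
    \<open>\<rho> u\<close> is \<open>(1 + norm (a' u)) / L\<close>, the quotient is bounded by
    \<open>L\<close>.\<close>
  define b where "b s = (1 / \<rho> (\<tau> s)) *\<^sub>R a' (\<tau> s)" for s
  have b[measurable]: "b \<in> borel_measurable borel" unfolding b_def by measurable
  have bbd: "norm (b s) \<le> L" for s
  proof -
    have "norm (b s) = L * (norm (a' (\<tau> s)) / (1 + norm (a' (\<tau> s))))"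
      using Lpos by (simp add: b_def \<rho>_def abs_mult abs_of_pos add_pos_nonneg)
    also have "\<dots> \<le> L * 1"
      using Lpos by (intro mult_left_mono) (auto simp: divide_le_eq_1 add_pos_nonneg)
    finally show ?thesis by simp
  qed
  have bm: "b \<in> borel_measurable (lebesgue_on {0..1})"
    by (intro measurable_restrict_space1 measurable_completion) simp
  interpret finite_measure "lebesgue_on {0..1::real}"
    by (simp add: finite_measure_lebesgue_on)
  have bi: "integrable (lebesgue_on {0..1}) b"
    using bbd by (intro integrable_const_bound[of _ L] bm) auto
  have meas: "(\<lambda>u. indicator {0..t} u * (word_integral c w u * (c u $ i))) \<in> borel_measurable borel"
    if c: "integrable (lebesgue_on {0..1}) c" "c \<in> borel_measurable borel" and t: "t \<le> 1"
    for c :: "real \<Rightarrow> real ^ 'd" and w i t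
  proof -
    have "continuous_on {0..t} (word_integral c w)"
      by (rule continuous_on_subset[OF continuous_on_word_integral[OF c(1)]]) (use t in auto)
    then have "(\<lambda>u. indicator {0..t} u *\<^sub>R word_integral c w u) \<in> borel_measurable borel"
      by (intro borel_measurable_continuous_on_indicator) auto
    moreover have "(\<lambda>u. c u $ i) \<in> borel_measurable borel"
      using c(2) by (rule measurable_compose) (intro borel_measurable_continuous_onI continuous_intros)
    ultimately have "(\<lambda>u. (indicator {0..t} u *\<^sub>R word_integral c w u) * (c u $ i)) \<in> borel_measurable borel"
      by (rule borel_measurable_times)
    then show ?thesis by (simp add: mult.assoc)
  qed
  \<comment> \<open>Iterated integrals are invariant under the change of time. The induction runs
    over all \<open>t\<close> because the inner integral is evaluated at every earlier time.\<close>
  have main: "word_integral b w (\<sigma> t) = word_integral a' w t" if "t \<in> {0..1}" for t w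
    using that
  proof (induction w arbitrary: t)
    case (Cons i w)
    have st: "0 \<le> \<sigma> t" "\<sigma> t \<le> 1" "t \<le> 1"
      using Cons.prems strict_mono_less_eq[OF \<sigma>(2)] \<sigma>(3,4) by (metis atLeastAtMost_iff)+
    have "word_integral b (i # w) (\<sigma> t)
        = (LINT s|lborel. indicator {0..\<sigma> t} s * (word_integral b w s * (b s $ i)))"
      unfolding word_integral.simps using meas[OF bi b st(2)] by (intro integral_lebesgue_on_eq_lborel) auto
    also have "\<dots> = (LINT s|distr (density lborel \<rho>) borel \<sigma>. indicator {0..\<sigma> t} s * (word_integral b w s * (b s $ i)))"
      unfolding push ..
    also have "\<dots> = (LINT u|density lborel \<rho>. indicator {0..\<sigma> t} (\<sigma> u) * (word_integral b w (\<sigma> u) * (b (\<sigma> u) $ i)))"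
      using meas[OF bi b st(2)] by (intro integral_distr) auto
    also have "\<dots> = (LINT u|lborel. \<rho> u *\<^sub>R (indicator {0..\<sigma> t} (\<sigma> u) * (word_integral b w (\<sigma> u) * (b (\<sigma> u) $ i))))"
      using measurable_compose[OF _ meas[OF bi b st(2)], of \<sigma> lborel] \<rho>pos
      by (intro integral_density) (auto simp: less_imp_le)
    also have "\<dots> = (LINT u|lborel. indicator {0..t} u * (word_integral a' w u * (a' u $ i)))"
    proof (rule Bochner_Integration.integral_cong)
      fix u
      have "indicator {0..\<sigma> t} (\<sigma> u) = (indicator {0..t} u :: real)"
        using strict_mono_less_eq[OF \<sigma>(2)] \<sigma>(3) by (auto simp: indicator_def) metis+
      moreover have "\<rho> u * (b (\<sigma> u) $ i) = a' u $ i"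
        using \<rho>pos[of u] by (simp add: b_def \<tau>\<sigma>)
      moreover have "word_integral b w (\<sigma> u) = word_integral a' w u" if "u \<in> {0..t}"
        using that Cons by auto
      ultimately show "\<rho> u *\<^sub>R (indicator {0..\<sigma> t} (\<sigma> u) * (word_integral b w (\<sigma> u) * (b (\<sigma> u) $ i)))
          = indicator {0..t} u * (word_integral a' w u * (a' u $ i))"
        by (cases "u \<in> {0..t}") (auto simp: algebra_simps)
    qed simp
    also have "\<dots> = word_integral a' (i # w) t"
      unfolding word_integral.simps using meas[OF a'i a' st(3)] by (intro integral_lebesgue_on_eq_lborel[symmetric]) auto
    finally show ?case .
  qed simp
  show thesis
  proof
    show "word_integral b w 1 = word_integral a w 1" for w
      using main[of 1 w] \<sigma>(4) word_integral_cong_AE[OF a a'i eq, of 1 w] by simp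
  qed (use bm bbd in auto)
qed

lemma word_integrals_in_signature_space:
  fixes a :: "real \<Rightarrow> real ^ 'd::finite"
  assumes a: "integrable (lebesgue_on {0..1}) a" and T: "T \<in> {0..1}"
  shows "(word_integrals a T :: ('d, 'n::finite) trunc_tensor) \<in> signature_space"
proof -
  let ?a = "\<lambda>u. if u \<in> {0..T} then a u else 0"
  have "integrable (lebesgue_on {0..T}) a"
    using integrable_lebesgue_on_subset[OF a, of "{0..T}"] T by auto
  then have "integrable lebesgue (\<lambda>u. if u \<in> {0..T} then a u else 0)"
    by (subst Lebesgue_Measure.integrable_restrict_UNIV) auto
  then have "integrable (lebesgue_on {0..1}) ?a"
    using integrable_lebesgue_on_subset[of UNIV ?a "{0..1}"] by (simp only: lebesgue_on_UNIV_eq) auto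
  then obtain b B where b: "b \<in> borel_measurable (lebesgue_on {0..1})" "\<And>s. norm (b s) \<le> B"
    "\<And>w. word_integral b w 1 = word_integral ?a w 1"
    using bounded_reparametrization by blast
  have "word_integrals a T = (word_integrals b 1 :: ('d, 'n) trunc_tensor)"
    unfolding word_integrals_def b(3) word_integral_restrict[OF T] ..
  then show ?thesis
    using signature_path_in_signature_space[OF b(1,2)] by simp
qed

text \<open>Existence turns the \<open>SOME\<close> into an actual solution, and uniqueness
  identifies its values on \<open>{0..1}\<close>. From here on the solution can be computed
  coordinate by coordinate.\<close>

lemma signature_curve_eq:
  fixes a :: "real \<Rightarrow> real ^ 'd::finite"
  assumes a: "integrable (lebesgue_on {0..1}) a" and t: "t \<in> {0..1}"
  shows "(signature_curve a t :: ('d, 'n::finite) trunc_tensor) = word_integrals a t"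
proof -
  have "is_signature_curve a (word_integrals a :: real \<Rightarrow> ('d, 'n) trunc_tensor)"
    unfolding is_signature_curve_def
  proof (intro conjI)
    show "word_integrals a ` {0..1} \<subseteq> (signature_space :: ('d, 'n) trunc_tensor set)"
      using word_integrals_in_signature_space[OF a, where 'n='n] by auto
    show "(word_integrals a 0 :: ('d, 'n) trunc_tensor) = tensor_one"
      by (subst word_integrals_solution[OF a]) simp_all
  qed (rule word_integrals_abs_continuous[OF a] word_integrals_derivative[OF a])+
  then have "is_signature_curve a (signature_curve a :: real \<Rightarrow> ('d, 'n) trunc_tensor)"
    unfolding signature_curve_def by (rule someI[where P="is_signature_curve a"])
  then show ?thesis
    using is_signature_curve_unique t \<open>is_signature_curve a (word_integrals a)\<close> by blast
qed

section \<open>Weak convergence of controls\<close>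

text \<open>Above \<open>l\<close> the factor \<open>y powr (1 - p)\<close> is at most
  \<open>l powr (1 - p)\<close>, because the exponent is negative.\<close>

lemma le_plus_powr:
  fixes p l y :: real
  assumes "1 < p" "0 < l" "0 \<le> y"
  shows "y \<le> l + l powr (1 - p) * y powr p"
proof (cases "y \<le> l")
  case False
  then have "y = y powr (1 - p) * y powr p"
    using assms by (simp flip: powr_add)
  also have "\<dots> \<le> l powr (1 - p) * y powr p"
    using assms False by (intro mult_right_mono powr_mono2') auto
  finally show ?thesis using assms by simp
qed (use assms in \<open>simp add: add_increasing2\<close>)

text \<open>This is Young's inequality for \<open>v\<close> and \<open>u powr (p - 1)\<close> with
  the conjugate exponents \<open>p\<close> and \<open>p / (p - 1)\<close>; nothing is
  differentiated, so \<open>u = 0\<close> needs no separate case.\<close>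

lemma powr_ge_tangent:
  fixes p u v :: real
  assumes p: "1 < p" and uv: "0 \<le> u" "0 \<le> v"
  shows "u powr p + p * u powr (p - 1) * (v - u) \<le> v powr p"
proof -
  have "v * u powr (p - 1) \<le> v powr p / p + (u powr (p - 1)) powr (p / (p - 1)) / (p / (p - 1))"
    using p uv by (intro Youngs_inequality) (auto simp: field_simps)
  also have "(u powr (p - 1)) powr (p / (p - 1)) = u powr p"
    using p by (simp add: powr_powr)
  finally have "p * (v * u powr (p - 1)) \<le> p * (v powr p / p + u powr p / (p / (p - 1)))"
    using p by (intro mult_left_mono) auto
  also have "\<dots> = v powr p + (p - 1) * u powr p"
    using p by (simp add: field_simps)
  finally have *: "p * (v * u powr (p - 1)) \<le> v powr p + (p - 1) * u powr p" .
  have base: "u powr p = u * u powr (p - 1)"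
    using uv by (simp add: powr_mult_base)
  have "p * u powr (p - 1) * (v - u) = p * (v * u powr (p - 1)) - p * u powr p"
    by (simp only: base) (simp only: algebra_simps)
  then show ?thesis using * by (simp add: left_diff_distrib)
qed

text \<open>Cauchy-Schwarz reduces this to the scalar inequality for the norms. The gradient term
  vanishes at \<open>x = 0\<close> also for \<open>p < 2\<close>, where its exponent is
  negative.\<close>

lemma norm_powr_ge_tangent:
  fixes x y :: "'b::real_inner"
  assumes p: "1 < p"
  shows "norm x powr p + p * (norm x powr (p - 2) * (x \<bullet> (y - x))) \<le> norm y powr p"
proof -
  have "x \<bullet> (y - x) \<le> norm x * (norm y - norm x)"
    using norm_cauchy_schwarz[of x y] by (simp add: inner_diff_right algebra_simps power2_norm_eq_inner[symmetric] power2_eq_square)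
  then have "norm x powr (p - 2) * (x \<bullet> (y - x)) \<le> norm x powr (p - 2) * (norm x * (norm y - norm x))"
    by (intro mult_left_mono) auto
  also have "\<dots> = norm x powr (p - 1) * (norm y - norm x)"
    using powr_mult_base[of "norm x" "p - 2"] by (simp add: mult.assoc[symmetric] mult.commute)
  finally have "p * (norm x powr (p - 2) * (x \<bullet> (y - x))) \<le> p * norm x powr (p - 1) * (norm y - norm x)"
    using p by (simp add: mult.assoc)
  then show ?thesis using powr_ge_tangent[OF p, of "norm x" "norm y"] by simp
qed

section \<open>Integral estimates for controls in L^p\<close>

lemma Lp_norm_powr:
  assumes "0 < p"
  shows "Lp_norm p a powr p = (LINT t|lebesgue_on {0..1}. norm (a t) powr p)"
  using assms by (simp add: Lp_norm_def powr_powr)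

lemma Lp_spaceD:
  assumes "a \<in> Lp_space p"
  shows "a \<in> borel_measurable (lebesgue_on {0..1})" "integrable (lebesgue_on {0..1}) (\<lambda>t. norm (a t) powr p)"
  using assms by (auto simp: Lp_space_def)

lemma Lp_space_integrable:
  assumes a: "a \<in> Lp_space p" and p: "1 < p"
  shows "integrable (lebesgue_on {0..1}) a"
proof (rule Bochner_Integration.integrable_bound)
  interpret finite_measure "lebesgue_on {0..1::real}" by (simp add: finite_measure_lebesgue_on)
  show "integrable (lebesgue_on {0..1}) (\<lambda>t. 1 + norm (a t) powr p)"
    using Lp_spaceD[OF a] by (intro Bochner_Integration.integrable_add integrable_const)
  show "AE t in lebesgue_on {0..1}. norm (a t) \<le> norm (1 + norm (a t) powr p)"
    using le_plus_powr[OF p, of 1] by (auto simp: add_nonneg_nonneg)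
qed (rule Lp_spaceD[OF a])

text \<open>Uniform integrability of the ball, with the parameter left open: a large
  \<open>l\<close> makes the second summand small uniformly over the ball since
  \<open>p > 1\<close>, and afterwards a small measure of \<open>E\<close> makes the first one
  small.\<close>

lemma Lp_equiintegrable:
  assumes a: "a \<in> Lp_space p" and p: "1 < p" and l: "0 < l" and E: "E \<in> sets (lebesgue_on {0..1})"
  shows "(LINT t|lebesgue_on {0..1}. indicator E t * norm (a t))
    \<le> l * measure (lebesgue_on {0..1}) E + l powr (1 - p) * Lp_norm p a powr p"
proof -
  interpret finite_measure "lebesgue_on {0..1::real}" by (simp add: finite_measure_lebesgue_on)
  note ai = Lp_spaceD[OF a] Lp_space_integrable[OF a p]
  have i1: "integrable (lebesgue_on {0..1}) (\<lambda>t. l * indicator E t)"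
    using E by (intro integrable_mult_right integrable_real_indicator) (auto simp: less_top[symmetric])
  have "(LINT t|lebesgue_on {0..1}. indicator E t * norm (a t))
      \<le> (LINT t|lebesgue_on {0..1}. l * indicator E t + l powr (1 - p) * norm (a t) powr p)"
  proof (rule integral_mono)
    show "integrable (lebesgue_on {0..1}) (\<lambda>t. indicator E t * norm (a t))"
      using integrable_mult_indicator[OF E integrable_norm[OF ai(3)]] by simp
    show "integrable (lebesgue_on {0..1}) (\<lambda>t. l * indicator E t + l powr (1 - p) * norm (a t) powr p)"
      using i1 ai(2) by simp
    show "indicator E t * norm (a t) \<le> l * indicator E t + l powr (1 - p) * norm (a t) powr p" for t
      using le_plus_powr[OF p l, of "norm (a t)"] by (auto simp: indicator_def)
  qed
  also have "\<dots> = l * measure (lebesgue_on {0..1}) E + l powr (1 - p) * Lp_norm p a powr p"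
    using i1 ai(2) E p sets.sets_into_space[OF E] by (simp add: Lp_norm_powr Int_absorb2)
  finally show ?thesis .
qed

text \<open>The choice \<open>l = Lp_norm p a\<close> makes both summands of the bound equal to the
  norm, hence the factor 2. If the norm vanishes, \<open>l\<close> may be taken arbitrarily
  small.\<close>

lemma Lp_norm_ge_L1:
  assumes a: "a \<in> Lp_space p" and p: "1 < p"
  shows "(LINT t|lebesgue_on {0..1}. norm (a t)) \<le> 2 * Lp_norm p a"
proof -
  let ?I = "LINT t|lebesgue_on {0..1}. norm (a t)"
  have *: "?I \<le> l + l powr (1 - p) * Lp_norm p a powr p" if "0 < l" for l
  proof -
    have "?I = (LINT t|lebesgue_on {0..1}. indicator {0..1} t * norm (a t))"
      by (intro Bochner_Integration.integral_cong) auto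
    also have "\<dots> \<le> l * measure (lebesgue_on {0..1}) {0..1::real} + l powr (1 - p) * Lp_norm p a powr p"
      by (rule Lp_equiintegrable[OF a p that]) auto
    also have "measure (lebesgue_on {0..1}) {0..1::real} = 1"
      by (subst measure_restrict_space) auto
    finally show ?thesis by simp
  qed
  show ?thesis
  proof (cases "Lp_norm p a = 0")
    case True
    then have "?I \<le> 0 + l" if "0 < l" for l using *[OF that] p by simp
    then have "?I \<le> 0" by (rule field_le_epsilon)
    then show ?thesis using True by simp
  next
    case False
    then have pos: "Lp_norm p a > 0" by (simp add: Lp_norm_def powr_ge_zero order.not_eq_order_implies_strict)
    then show ?thesis using *[OF pos] by (simp flip: powr_add)
  qed
qed

text \<open>Convergence tested against bounded functions only. It is implied by weak convergence in \<open>L\<^sup>p\<close> for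
  every \<open>p > 1\<close>, and on \<open>L\<^sup>p\<close>-bounded families it suffices for the continuity of the endpoint map and
  for lower semicontinuity, so neither the dual of \<open>L\<^sup>p\<close> nor a Hoelder inequality is needed.\<close>
definition bounded_weak_tendsto ::
  "'a measure \<Rightarrow> ('i \<Rightarrow> 'a \<Rightarrow> 'b::euclidean_space) \<Rightarrow> ('a \<Rightarrow> 'b) \<Rightarrow> 'i filter \<Rightarrow> bool" where
  "bounded_weak_tendsto M fam a F \<longleftrightarrow>
    (\<forall>g\<in>borel_measurable M. \<forall>B. (\<forall>t. norm (g t) \<le> B) \<longrightarrow>
      ((\<lambda>n. LINT t|M. g t \<bullet> fam n t) \<longlongrightarrow> (LINT t|M. g t \<bullet> a t)) F)"

lemma bounded_weak_tendstoD:
  assumes "bounded_weak_tendsto M fam a F" "g \<in> borel_measurable M" "\<And>t. norm (g t) \<le> B"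
  shows "((\<lambda>n. LINT t|M. g t \<bullet> fam n t) \<longlongrightarrow> (LINT t|M. g t \<bullet> a t)) F"
  using assms by (auto simp: bounded_weak_tendsto_def)

lemma integrable_bounded_inner:
  fixes a g :: "'a \<Rightarrow> 'b::euclidean_space"
  assumes a: "integrable M a" and g: "g \<in> borel_measurable M" "\<And>t. norm (g t) \<le> B"
  shows "integrable M (\<lambda>t. g t \<bullet> a t)"
proof (rule Bochner_Integration.integrable_bound)
  show "integrable M (\<lambda>t. B * norm (a t))" using a by (intro integrable_mult_right integrable_norm)
  show "(\<lambda>t. g t \<bullet> a t) \<in> borel_measurable M" using a g(1) by measurable
  show "AE t in M. norm (g t \<bullet> a t) \<le> norm (B * norm (a t))"
  proof (rule AE_I2)
    fix t
    have "\<bar>g t \<bullet> a t\<bar> \<le> norm (g t) * norm (a t)" by (rule Cauchy_Schwarz_ineq2)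
    also have "\<dots> \<le> B * norm (a t)" by (intro mult_right_mono g) auto
    finally show "norm (g t \<bullet> a t) \<le> norm (B * norm (a t))" by simp
  qed
qed

text \<open>Pairing with a function bounded by \<open>B\<close> is a continuous functional, because
  \<open>Lp_norm_ge_L1\<close> bounds it by \<open>2 * B\<close> times the norm.\<close>

lemma Lp_weak_tendsto_imp_bounded:
  fixes fam :: "'i \<Rightarrow> real \<Rightarrow> 'b::euclidean_space"
  assumes p: "1 < p" and w: "Lp_weak_tendsto p fam a F"
  shows "bounded_weak_tendsto (lebesgue_on {0..1}) fam a F"
  unfolding bounded_weak_tendsto_def
proof (intro ballI allI impI)
  fix g :: "real \<Rightarrow> 'b" and B :: real
  assume g: "g \<in> borel_measurable (lebesgue_on {0..1})" and B: "\<forall>t. norm (g t) \<le> B"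
  have Bpos: "0 \<le> B" using B norm_ge_zero order_trans by blast
  let ?\<phi> = "\<lambda>b. LINT t|lebesgue_on {0..1}. g t \<bullet> b t"
  have int: "integrable (lebesgue_on {0..1}) (\<lambda>t. g t \<bullet> b t)" if "b \<in> Lp_space p" for b
    using integrable_bounded_inner[OF Lp_space_integrable[OF that p] g] B by auto
  have "?\<phi> \<in> Lp_dual p"
    unfolding Lp_dual_def
  proof (intro CollectI conjI ballI allI)
    fix b c :: "real \<Rightarrow> 'b" assume "b \<in> Lp_space p" "c \<in> Lp_space p"
    then show "?\<phi> (\<lambda>t. b t + c t) = ?\<phi> b + ?\<phi> c"
      using int by (simp add: inner_add_right)
  next
    fix r and b :: "real \<Rightarrow> 'b" show "?\<phi> (\<lambda>t. r *\<^sub>R b t) = r * ?\<phi> b" by simp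
  next
    show "\<exists>C. \<forall>b\<in>Lp_space p. \<bar>?\<phi> b\<bar> \<le> C * Lp_norm p b"
    proof (intro exI ballI)
      fix b :: "real \<Rightarrow> 'b" assume b: "b \<in> Lp_space p"
      have "\<bar>?\<phi> b\<bar> \<le> (LINT t|lebesgue_on {0..1}. \<bar>g t \<bullet> b t\<bar>)" by (rule integral_abs_bound)
      also have "\<dots> \<le> (LINT t|lebesgue_on {0..1}. B * norm (b t))"
      proof (rule integral_mono)
        fix t
        have "\<bar>g t \<bullet> b t\<bar> \<le> norm (g t) * norm (b t)" by (rule Cauchy_Schwarz_ineq2)
        also have "\<dots> \<le> B * norm (b t)" using B by (intro mult_right_mono) auto
        finally show "\<bar>g t \<bullet> b t\<bar> \<le> B * norm (b t)" .
      qed (use int[OF b] Lp_space_integrable[OF b p] in auto)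
      also have "\<dots> = B * (LINT t|lebesgue_on {0..1}. norm (b t))" by simp
      also have "\<dots> \<le> B * (2 * Lp_norm p b)"
        using Bpos Lp_norm_ge_L1[OF b p] by (intro mult_left_mono)
      finally show "\<bar>?\<phi> b\<bar> \<le> (B * 2) * Lp_norm p b" by simp
    qed
  qed
  then show "((\<lambda>n. ?\<phi> (fam n)) \<longlongrightarrow> ?\<phi> a) F"
    by (rule bspec[OF w[unfolded Lp_weak_tendsto_def]])
qed

text \<open>An Arzela-Ascoli argument: a finite net carries the pointwise convergence, and
  equicontinuity spreads it to the other points. Equicontinuity is asked only eventually along
  \<open>F\<close>, because the families considered lie in the ball only eventually.\<close>

lemma tendsto_uniformly_equicontinuous:
  fixes \<Phi> :: "'i \<Rightarrow> 'a::metric_space \<Rightarrow> 'b::metric_space"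
  assumes S: "compact S" and cont: "continuous_on S f"
    and lim: "\<And>t. t \<in> S \<Longrightarrow> ((\<lambda>n. \<Phi> n t) \<longlongrightarrow> f t) F"
    and equi: "\<And>e. e > 0 \<Longrightarrow> \<exists>d>0. \<forall>\<^sub>F n in F. \<forall>s\<in>S. \<forall>t\<in>S. dist s t < d \<longrightarrow> dist (\<Phi> n s) (\<Phi> n t) < e"
  shows "uniform_limit S \<Phi> f F"
  unfolding uniform_limit_iff
proof (intro allI impI)
  fix e :: real assume "e > 0"
  then have e3: "e / 3 > 0" by simp
  obtain d1 where d1: "d1 > 0"
      "\<forall>\<^sub>F n in F. \<forall>s\<in>S. \<forall>t\<in>S. dist s t < d1 \<longrightarrow> dist (\<Phi> n s) (\<Phi> n t) < e / 3"
    using equi[OF e3] by blast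
  obtain d2 where d2: "d2 > 0" "\<And>s t. s \<in> S \<Longrightarrow> t \<in> S \<Longrightarrow> dist s t < d2 \<Longrightarrow> dist (f s) (f t) < e / 3"
    using compact_uniformly_continuous[OF cont S] e3 unfolding uniformly_continuous_on_def by metis
  obtain T where T: "finite T" "T \<subseteq> S" "S \<subseteq> (\<Union>x\<in>T. ball x (min d1 d2))"
    using compactE_image[OF S, of S "\<lambda>x. ball x (min d1 d2)"] d1(1) d2(1)
    by (metis (no_types, lifting) UN_I centre_in_ball min_less_iff_conj open_ball subsetI)
  have "\<forall>\<^sub>F n in F. \<forall>x\<in>T. dist (\<Phi> n x) (f x) < e / 3"
    using T(1,2) e3 by (intro eventually_ball_finite ballI tendstoD lim) auto
  with d1(2) show "\<forall>\<^sub>F n in F. \<forall>t\<in>S. dist (\<Phi> n t) (f t) < e"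
  proof eventually_elim
    case (elim n)
    show ?case
    proof
      fix t assume t: "t \<in> S"
      obtain x where x: "x \<in> T" "dist x t < min d1 d2" using T(3) t by auto
      have "dist (\<Phi> n t) (f t) \<le> dist (\<Phi> n x) (\<Phi> n t) + dist (\<Phi> n x) (f x) + dist (f x) (f t)"
        using dist_triangle[of "\<Phi> n t" "f t" "\<Phi> n x"] dist_triangle[of "\<Phi> n x" "f t" "f x"]
        by (simp add: dist_commute)
      also have "\<dots> < e / 3 + e / 3 + e / 3"
        using elim x t T(2) d2(2)[of x t] by (intro add_strict_mono) auto
      finally show "dist (\<Phi> n t) (f t) < e" by simp
    qed
  qed
qed

text \<open>Each step integrates a product in which the control converges only weakly, so the other
  factor has to converge uniformly; hence the induction carries uniform limits. Replacing that
  factor by its limit costs its uniform distance times a bound on the integral of the norm of the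
  control.\<close>

lemma uniform_limit_word_integral:
  fixes fam :: "'i \<Rightarrow> real \<Rightarrow> real ^ 'd::finite"
  assumes p: "1 < p" and c: "0 < c"
    and fam: "\<forall>\<^sub>F n in F. fam n \<in> control_ball p c"
    and a: "a \<in> Lp_space p"
    and w: "bounded_weak_tendsto (lebesgue_on {0..1}) fam a F"
  shows "uniform_limit {0..1} (\<lambda>n. word_integral (fam n) v) (word_integral a v) F"
proof (induction v)
  case Nil
  then show ?case by (simp add: uniform_limit_iff)
next
  case (Cons i v)
  let ?M = "lebesgue_on {0..1::real}"
  let ?W = "word_integral a v"
  interpret finite_measure ?M by (simp add: finite_measure_lebesgue_on)
  have ai: "integrable ?M a" by (rule Lp_space_integrable[OF a p])
  have W: "continuous_on {0..1} ?W" by (rule continuous_on_word_integral[OF ai])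
  have "bounded (?W ` {0..1})"
    by (rule compact_imp_bounded[OF compact_continuous_image[OF W compact_Icc]])
  then obtain B where "B > 0" "\<forall>x\<in>?W ` {0..1}. norm x \<le> B" unfolding bounded_pos by blast
  then have B: "B > 0" "\<And>t. t \<in> {0..1} \<Longrightarrow> \<bar>?W t\<bar> \<le> B" by (metis, metis imageI real_norm_def)
  have Wm: "?W \<in> borel_measurable ?M"
    by (rule continuous_imp_measurable_on_sets_lebesgue[OF W]) auto
  \<comment> \<open>The next iterated integral with the inner factor frozen at its limit
    \<open>?W\<close>, which makes it linear in the control.\<close>
  define \<Phi> where "\<Phi> b t = integral {0..t} (\<lambda>u. ?W u * (b u $ i))" for b t
  have int: "integrable (lebesgue_on S) (\<lambda>u. ?W u * (b u $ i))"
    if "b \<in> Lp_space p" "S \<subseteq> {0..1}" "S \<in> sets lebesgue" for b S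
    by (rule integrable_lebesgue_on_subset[OF integrable_continuous_mult[OF W integrable_vec_nth[OF Lp_space_integrable[OF that(1) p]]] that(2,3)]) auto
  \<comment> \<open>Written as a pairing with the bounded function \<open>?W\<close> times a basis
    vector, cut off at \<open>t\<close>, convergence at a fixed \<open>t\<close> becomes an instance
    of weak convergence.\<close>
  have \<Phi>_inner: "\<Phi> b t = (LINT u|?M. (indicator {0..t} u * indicator {0..1} u * ?W u) *\<^sub>R axis i 1 \<bullet> b u)"
    if b: "b \<in> Lp_space p" and t: "t \<in> {0..1}" for b t
  proof -
    have "\<Phi> b t = (LINT u|lebesgue_on {0..t}. ?W u * (b u $ i))"
      unfolding \<Phi>_def using int[OF b, of "{0..t}"] t by (subst lebesgue_integral_eq_integral) auto
    also have "\<dots> = (LINT u|?M. (if u \<in> {0..t} then ?W u * (b u $ i) else 0))"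
      using t by (intro integral_restrict[symmetric]) auto
    finally show ?thesis
      by (auto intro!: Bochner_Integration.integral_cong simp: indicator_def inner_axis')
  qed
  have \<Phi>_diff: "\<bar>\<Phi> b t - \<Phi> b s\<bar> \<le> B * (l * \<bar>t - s\<bar> + l powr (1 - p) * c powr p)"
    if b: "b \<in> control_ball p c" and st: "s \<in> {0..1}" "t \<in> {0..1}" "s \<le> t" and l: "l > 0" for b s t l
  proof -
    have bL: "b \<in> Lp_space p" and bc: "Lp_norm p b \<le> c" using b by (auto simp: control_ball_def)
    have "\<Phi> b t - \<Phi> b s = integral {s..t} (\<lambda>u. ?W u * (b u $ i))"
      unfolding \<Phi>_def
      using Henstock_Kurzweil_Integration.integral_combine[of 0 s t "\<lambda>u. ?W u * (b u $ i)"] st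
        integrable_on_lebesgue_on[OF int[OF bL, of "{0..t}"]] by auto
    also have "\<dots> = (LINT u|lebesgue_on {s..t}. ?W u * (b u $ i))"
      using int[OF bL, of "{s..t}"] st by (subst lebesgue_integral_eq_integral) auto
    also have "\<dots> = (LINT u|?M. (if u \<in> {s..t} then ?W u * (b u $ i) else 0))"
      using st by (intro integral_restrict[symmetric]) auto
    also have "\<bar>\<dots>\<bar> \<le> (LINT u|?M. \<bar>if u \<in> {s..t} then ?W u * (b u $ i) else 0\<bar>)"
      by (rule integral_abs_bound)
    also have "\<dots> \<le> (LINT u|?M. B * (indicator {s..t} u * norm (b u)))"
    proof (rule integral_mono_AE')
      have "{s..t} \<in> sets ?M" using st by (simp add: sets_restrict_space_iff)
      from integrable_mult_indicator[OF this integrable_norm[OF Lp_space_integrable[OF bL p]]]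
      show "integrable ?M (\<lambda>u. B * (indicator {s..t} u * norm (b u)))" by simp
      show "AE u in ?M. \<bar>if u \<in> {s..t} then ?W u * (b u $ i) else 0\<bar> \<le> B * (indicator {s..t} u * norm (b u))"
      proof (rule AE_I2)
        fix u assume "u \<in> space ?M"
        then have "\<bar>?W u * (b u $ i)\<bar> \<le> B * norm (b u)"
          using B component_le_norm_cart[of "b u" i] by (simp add: abs_mult mult_mono)
        then show "\<bar>if u \<in> {s..t} then ?W u * (b u $ i) else 0\<bar> \<le> B * (indicator {s..t} u * norm (b u))"
          by (simp add: indicator_def)
      qed
    qed (use B in auto)
    also have "\<dots> = B * (LINT u|?M. indicator {s..t} u * norm (b u))" by simp
    also have "\<dots> \<le> B * (l * measure ?M {s..t} + l powr (1 - p) * Lp_norm p b powr p)"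
      using B(1) st by (intro mult_left_mono Lp_equiintegrable[OF bL p l]) (auto simp: sets_restrict_space_iff)
    also have "measure ?M {s..t} = \<bar>t - s\<bar>"
      using st by (subst measure_restrict_space) auto
    also have "B * (l * \<bar>t - s\<bar> + l powr (1 - p) * Lp_norm p b powr p) \<le> B * (l * \<bar>t - s\<bar> + l powr (1 - p) * c powr p)"
      using bc B(1) p by (intro mult_left_mono add_left_mono powr_mono2) (auto simp: Lp_norm_def)
    finally show ?thesis .
  qed
  have lim\<Phi>: "uniform_limit {0..1} (\<lambda>n. \<Phi> (fam n)) (\<Phi> a) F"
  proof (rule tendsto_uniformly_equicontinuous)
    show "continuous_on {0..1} (\<Phi> a)"
      unfolding \<Phi>_def using int[OF a, of "{0..1}"] by (intro indefinite_integral_continuous_1 integrable_on_lebesgue_on) auto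
  next
    fix t :: real assume t: "t \<in> {0..1}"
    let ?g = "\<lambda>u. (indicator {0..t} u * indicator {0..1} u * ?W u) *\<^sub>R axis i 1 :: real ^ 'd"
    have "((\<lambda>n. LINT u|?M. ?g u \<bullet> fam n u) \<longlongrightarrow> (LINT u|?M. ?g u \<bullet> a u)) F"
    proof (rule bounded_weak_tendstoD[OF w])
      have "{0..t} \<in> sets ?M" using t by (simp add: sets_restrict_space_iff)
      then show "?g \<in> borel_measurable ?M"
        by (intro borel_measurable_scaleR borel_measurable_times borel_measurable_indicator Wm borel_measurable_const) auto
      show "norm (?g u) \<le> B" for u using B by (auto simp: indicator_def norm_axis_1 less_imp_le)
    qed
    moreover have "\<forall>\<^sub>F n in F. (LINT u|?M. ?g u \<bullet> fam n u) = \<Phi> (fam n) t"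
      using fam by eventually_elim (use \<Phi>_inner[OF _ t] in \<open>auto simp: control_ball_def\<close>)
    ultimately show "((\<lambda>n. \<Phi> (fam n) t) \<longlongrightarrow> \<Phi> a t) F"
      unfolding \<Phi>_inner[OF a t] by (rule Lim_transform_eventually)
  next
    fix e :: real assume e: "e > 0"
    \<comment> \<open>A large \<open>l\<close> first makes the part of \<open>\<Phi>_diff\<close>
      that is independent of the two times less than \<open>e / 2\<close>. With \<open>l\<close>
      fixed, a time distance below \<open>e / (2 * B * l)\<close> does the same for the other
      part.\<close>
    have "((\<lambda>l. B * (l powr (1 - p) * c powr p)) \<longlongrightarrow> B * (0 * c powr p)) at_top"
      using p by (intro tendsto_intros tendsto_neg_powr filterlim_ident) auto
    then have "\<forall>\<^sub>F l in at_top. B * (l powr (1 - p) * c powr p) < e / 2"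
      by (rule order_tendstoD) (use e in auto)
    then have "\<forall>\<^sub>F l in at_top. B * (l powr (1 - p) * c powr p) < e / 2 \<and> l > 0"
      using eventually_gt_at_top[of 0] by eventually_elim simp
    then obtain l where l: "B * (l powr (1 - p) * c powr p) < e / 2" "l > 0"
      by (metis (mono_tags, lifting) eventually_at_top_linorder order_refl)
    have sym: "\<bar>\<Phi> b s - \<Phi> b t\<bar> \<le> B * (l * \<bar>s - t\<bar> + l powr (1 - p) * c powr p)"
      if "b \<in> control_ball p c" "s \<in> {0..1}" "t \<in> {0..1}" for b s t
      using \<Phi>_diff[OF that(1) _ _ _ l(2), of s t] \<Phi>_diff[OF that(1) _ _ _ l(2), of t s] that(2,3)
      by (cases "s \<le> t") (simp_all add: abs_minus_commute)
    show "\<exists>d>0. \<forall>\<^sub>F n in F. \<forall>s\<in>{0..1}. \<forall>t\<in>{0..1}. dist s t < d \<longrightarrow> dist (\<Phi> (fam n) s) (\<Phi> (fam n) t) < e"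
    proof (intro exI conjI)
      show "e / (2 * B * l) > 0" using e B l by simp
      show "\<forall>\<^sub>F n in F. \<forall>s\<in>{0..1}. \<forall>t\<in>{0..1}. dist s t < e / (2 * B * l) \<longrightarrow> dist (\<Phi> (fam n) s) (\<Phi> (fam n) t) < e"
        using fam
      proof eventually_elim
        case (elim n)
        show ?case
        proof (intro ballI impI)
          fix s t :: real assume st: "s \<in> {0..1}" "t \<in> {0..1}" "dist s t < e / (2 * B * l)"
          have "B * l * \<bar>s - t\<bar> < B * l * (e / (2 * B * l))"
            using st(3) B(1) l(2) by (intro mult_strict_left_mono) (auto simp: dist_real_def)
          also have "\<dots> = e / 2" using B(1) l(2) by simp
          finally show "dist (\<Phi> (fam n) s) (\<Phi> (fam n) t) < e"
            using sym[OF elim st(1,2)] l(1) by (simp add: dist_real_def algebra_simps)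
        qed
      qed
    qed
  qed simp
  show ?case
    unfolding uniform_limit_iff
  proof (intro allI impI)
    fix e :: real assume e: "e > 0"
    have "\<forall>\<^sub>F n in F. \<forall>t\<in>{0..1}. dist (\<Phi> (fam n) t) (\<Phi> a t) < e / 2"
      using uniform_limitD[OF lim\<Phi>, of "e / 2"] e by simp
    \<comment> \<open>\<open>4 * c\<close>, since the integral of the norm of a control in the ball
      is at most \<open>2 * c\<close> and the replacement may cost \<open>e / 2\<close>.\<close>
    moreover have "\<forall>\<^sub>F n in F. \<forall>t\<in>{0..1}. dist (word_integral (fam n) v t) (?W t) < e / (4 * c)"
      using uniform_limitD[OF Cons, of "e / (4 * c)"] e c by simp
    ultimately show "\<forall>\<^sub>F n in F. \<forall>t\<in>{0..1}. dist (word_integral (fam n) (i # v) t) (word_integral a (i # v) t) < e"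
      using fam
    proof eventually_elim
      case (elim n)
      let ?b = "fam n"
      let ?Wn = "word_integral (fam n) v"
      have bL: "?b \<in> Lp_space p" and bc: "Lp_norm p ?b \<le> c" using elim by (auto simp: control_ball_def)
      have bi: "integrable ?M ?b" by (rule Lp_space_integrable[OF bL p])
      have Wn: "continuous_on {0..1} ?Wn" by (rule continuous_on_word_integral[OF bi])
      show ?case
      proof
        fix t :: real assume t: "t \<in> {0..1}"
        have i1: "(\<lambda>u. ?Wn u * (?b u $ i)) integrable_on {0..t}" "(\<lambda>u. ?W u * (?b u $ i)) integrable_on {0..t}"
          using t integrable_lebesgue_on_subset[OF integrable_word_integral[OF bi], of "{0..t}"] int[OF bL, of "{0..t}"]
          by (auto intro!: integrable_on_lebesgue_on)
        have i2: "integrable ?M (\<lambda>u. (?Wn u - ?W u) * (?b u $ i))"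
          by (intro integrable_continuous_mult integrable_vec_nth bi continuous_on_diff Wn W)
        have "word_integral ?b (i # v) t - \<Phi> ?b t = integral {0..t} (\<lambda>u. (?Wn u - ?W u) * (?b u $ i))"
          unfolding \<Phi>_def using t word_integral_Cons[OF bi, of t i v]
            Henstock_Kurzweil_Integration.integral_diff[OF i1] by (simp add: left_diff_distrib del: word_integral.simps)
        also have "\<dots> = (LINT u|lebesgue_on {0..t}. (?Wn u - ?W u) * (?b u $ i))"
          using integrable_lebesgue_on_subset[OF i2, of "{0..t}"] t by (subst lebesgue_integral_eq_integral) auto
        also have "\<bar>\<dots>\<bar> \<le> (LINT u|lebesgue_on {0..t}. \<bar>(?Wn u - ?W u) * (?b u $ i)\<bar>)"
          by (rule integral_abs_bound)
        also have "\<dots> \<le> (LINT u|?M. e / (4 * c) * norm (?b u))"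
        proof (rule integral_mono_lebesgue_on_AE)
          show "integrable ?M (\<lambda>u. e / (4 * c) * norm (?b u))" using bi by (intro integrable_mult_right integrable_norm)
          show "AE u in lebesgue_on {0..t}. \<bar>(?Wn u - ?W u) * (?b u $ i)\<bar> \<le> e / (4 * c) * norm (?b u)"
          proof (rule AE_I2)
            fix u assume "u \<in> space (lebesgue_on {0..t})"
            then have "\<bar>?Wn u - ?W u\<bar> \<le> e / (4 * c)" using elim(2) t by (auto simp: dist_real_def less_imp_le)
            then show "\<bar>(?Wn u - ?W u) * (?b u $ i)\<bar> \<le> e / (4 * c) * norm (?b u)"
              using component_le_norm_cart[of "?b u" i] e c by (simp only: abs_mult) (intro mult_mono, auto)
          qed
        qed (use t e c in auto)
        also have "\<dots> = e / (4 * c) * (LINT u|?M. norm (?b u))" by simp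
        also have "\<dots> \<le> e / (4 * c) * (2 * c)"
          using Lp_norm_ge_L1[OF bL p] bc e c by (intro mult_left_mono) auto
        also have "\<dots> = e / 2" using c by simp
        finally have "\<bar>word_integral ?b (i # v) t - \<Phi> ?b t\<bar> \<le> e / 2" .
        moreover have "\<bar>\<Phi> ?b t - \<Phi> a t\<bar> < e / 2" using elim(1) t by (simp add: dist_real_def)
        moreover have "word_integral a (i # v) t = \<Phi> a t"
          unfolding \<Phi>_def by (rule word_integral_Cons[OF ai]) (use t in simp)
        ultimately show "dist (word_integral ?b (i # v) t) (word_integral a (i # v) t) < e"
          unfolding dist_real_def by linarith
      qed
    qed
  qed
qed

lemma tendsto_signature_curve:
  fixes fam :: "'i \<Rightarrow> real \<Rightarrow> real ^ 'd::finite"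
  assumes p: "1 < p" and c: "0 < c"
    and fam: "\<forall>\<^sub>F n in F. fam n \<in> control_ball p c"
    and a: "a \<in> Lp_space p"
    and w: "bounded_weak_tendsto (lebesgue_on {0..1}) fam a F"
  shows "((\<lambda>n. signature_curve (fam n) 1 :: ('d, 'n::finite) trunc_tensor) \<longlongrightarrow> signature_curve a 1) F"
proof -
  have "((\<lambda>n. word_integrals (fam n) 1 :: ('d, 'n) trunc_tensor) \<longlongrightarrow> word_integrals a 1) F"
    unfolding word_integrals_def
    by (intro vec_tendstoI) (simp add: tendsto_uniform_limitI[OF uniform_limit_word_integral[OF assms]])
  moreover have "\<forall>\<^sub>F n in F. (word_integrals (fam n) 1 :: ('d, 'n) trunc_tensor) = signature_curve (fam n) 1"
    using fam by eventually_elim (simp add: control_ball_def signature_curve_eq Lp_space_integrable[OF _ p])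
  ultimately show ?thesis
    using signature_curve_eq[OF Lp_space_integrable[OF a p], of 1, where 'n='n]
    by (simp add: Lim_transform_eventually)
qed

lemma signature_curve_in_signature_space:
  assumes "a \<in> Lp_space p" "1 < p"
  shows "(signature_curve a 1 :: ('d::finite, 'n::finite) trunc_tensor) \<in> signature_space"
  using word_integrals_in_signature_space[OF Lp_space_integrable[OF assms], where 'n='n, of 1]
    signature_curve_eq[OF Lp_space_integrable[OF assms], where 'n='n, of 1] by simp

text \<open>Integrating the tangent inequality of \<open>\<lambda>x. |x|\<^sup>p\<close> at \<open>a\<close>; the truncation at height \<open>K\<close> makes the
  gradient \<open>|a|\<^sup>p\<^sup>-\<^sup>2 a\<close> a bounded test function.\<close>
lemma weak_limit_powr_truncated_less:
  fixes a :: "'a \<Rightarrow> 'b::euclidean_space"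
  assumes M: "finite_measure M" and p: "1 < p" and a: "integrable M a"
    and w: "bounded_weak_tendsto M fam a F"
    and fam: "\<forall>\<^sub>F n in F. integrable M (fam n) \<and> integrable M (\<lambda>t. norm (fam n t) powr p)"
    and y: "y < (LINT t|M. (if norm (a t) \<le> K then norm (a t) powr p else 0))"
  shows "\<forall>\<^sub>F n in F. y < (LINT t|M. norm (fam n t) powr p)"
proof -
  interpret finite_measure M by fact
  have am[measurable]: "a \<in> borel_measurable M" using a by auto
  define g where "g t = (if norm (a t) \<le> K then norm (a t) powr (p - 2) *\<^sub>R a t else 0)" for t
  let ?T = "\<lambda>t. if norm (a t) \<le> K then norm (a t) powr p else 0"
  have gm: "g \<in> borel_measurable M" unfolding g_def by measurable
  have gb: "norm (g t) \<le> \<bar>K\<bar> powr (p - 1)" for t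
  proof (cases "norm (a t) \<le> K")
    case True
    have "norm (g t) = norm (a t) powr (p - 1)"
      using True powr_mult_base[of "norm (a t)" "p - 2"] by (simp add: g_def mult.commute)
    also have "\<dots> \<le> \<bar>K\<bar> powr (p - 1)" using True p by (intro powr_mono2) auto
    finally show ?thesis .
  qed (simp add: g_def)
  have Ti: "integrable M ?T"
    using p by (intro integrable_const_bound[of _ "\<bar>K\<bar> powr p"]) (auto intro!: AE_I2 powr_mono2)
  have gai: "integrable M (\<lambda>t. g t \<bullet> a t)" by (rule integrable_bounded_inner[OF a gm gb])
  have "((\<lambda>n. p * ((LINT t|M. g t \<bullet> fam n t) - (LINT t|M. g t \<bullet> a t))) \<longlongrightarrow>
      p * ((LINT t|M. g t \<bullet> a t) - (LINT t|M. g t \<bullet> a t))) F"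
    by (intro tendsto_intros bounded_weak_tendstoD[OF w gm gb])
  then have "\<forall>\<^sub>F n in F. y - (LINT t|M. ?T t) < p * ((LINT t|M. g t \<bullet> fam n t) - (LINT t|M. g t \<bullet> a t))"
    by (rule order_tendstoD) (use y in auto)
  then show ?thesis
    using fam
  proof eventually_elim
    case (elim n)
    have gi: "integrable M (\<lambda>t. g t \<bullet> fam n t)" by (rule integrable_bounded_inner[OF _ gm gb]) (use elim in auto)
    have "(LINT t|M. ?T t) + p * ((LINT t|M. g t \<bullet> fam n t) - (LINT t|M. g t \<bullet> a t))
        = (LINT t|M. ?T t + p * (g t \<bullet> fam n t - g t \<bullet> a t))"
      using Ti gi gai by simp
    also have "\<dots> \<le> (LINT t|M. norm (fam n t) powr p)"
    proof (rule integral_mono)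
      show "integrable M (\<lambda>t. ?T t + p * (g t \<bullet> fam n t - g t \<bullet> a t))" using Ti gi gai by simp
      \<comment> \<open>Where \<open>norm (a t)\<close> exceeds \<open>K\<close>, both summands on
        the left vanish and only nonnegativity of the power remains.\<close>
      show "?T t + p * (g t \<bullet> fam n t - g t \<bullet> a t) \<le> norm (fam n t) powr p" for t
        using norm_powr_ge_tangent[OF p, of "a t" "fam n t"] by (simp add: g_def inner_diff_right algebra_simps)
    qed (use elim in auto)
    finally show ?case using elim(1) by linarith
  qed
qed

lemma tendsto_truncated:
  fixes v :: "'a \<Rightarrow> real" and u :: "'a \<Rightarrow> real"
  shows "(\<lambda>k. if v t \<le> real k then u t else 0) \<longlonglongrightarrow> u t"
proof (rule tendsto_eventually)
  show "\<forall>\<^sub>F k in sequentially. (if v t \<le> real k then u t else 0) = u t"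
    using eventually_ge_at_top[of "nat \<lceil>v t\<rceil>"] by eventually_elim (simp add: nat_le_iff ceiling_le_iff)
qed

lemma weak_limit_powr_less:
  fixes a :: "'a \<Rightarrow> 'b::euclidean_space"
  assumes M: "finite_measure M" and p: "1 < p" and a: "integrable M a"
    and ap: "integrable M (\<lambda>t. norm (a t) powr p)"
    and w: "bounded_weak_tendsto M fam a F"
    and fam: "\<forall>\<^sub>F n in F. integrable M (fam n) \<and> integrable M (\<lambda>t. norm (fam n t) powr p)"
    and y: "y < (LINT t|M. norm (a t) powr p)"
  shows "\<forall>\<^sub>F n in F. y < (LINT t|M. norm (fam n t) powr p)"
proof -
  have [measurable]: "a \<in> borel_measurable M" using a by auto
  have "(\<lambda>k. LINT t|M. (if norm (a t) \<le> real k then norm (a t) powr p else 0)) \<longlonglongrightarrow> (LINT t|M. norm (a t) powr p)"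
    by (rule integral_dominated_convergence[OF _ _ ap]) (auto intro!: AE_I2 tendsto_truncated)
  then have "\<forall>\<^sub>F k in sequentially. y < (LINT t|M. (if norm (a t) \<le> real k then norm (a t) powr p else 0))"
    by (rule order_tendstoD) (rule y)
  then obtain k where "y < (LINT t|M. (if norm (a t) \<le> real k then norm (a t) powr p else 0))"
    by (auto simp: eventually_sequentially)
  then show ?thesis by (rule weak_limit_powr_truncated_less[OF M p a w fam])
qed

text \<open>Integrability of the power of the limit is a conclusion here: the bound for the
  truncations is independent of the height, and monotone convergence removes them. This puts a weak
  limit, at first only integrable, into the ball.\<close>

lemma weak_limit_powr_le:
  fixes a :: "'a \<Rightarrow> 'b::euclidean_space"
  assumes M: "finite_measure M" and p: "1 < p" and a: "integrable M a" and F: "F \<noteq> bot"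
    and w: "bounded_weak_tendsto M fam a F"
    and fam: "\<forall>\<^sub>F n in F. integrable M (fam n) \<and> integrable M (\<lambda>t. norm (fam n t) powr p)"
    and C: "\<forall>\<^sub>F n in F. (LINT t|M. norm (fam n t) powr p) \<le> C"
  shows "integrable M (\<lambda>t. norm (a t) powr p)" "(LINT t|M. norm (a t) powr p) \<le> C"
proof -
  interpret finite_measure M by fact
  have [measurable]: "a \<in> borel_measurable M" using a by auto
  let ?T = "\<lambda>k t. if norm (a t) \<le> real k then norm (a t) powr p else 0"
  have Ti: "integrable M (?T k)" for k
    using p by (intro integrable_const_bound[of _ "real k powr p"]) (auto intro!: AE_I2 powr_mono2)
  have TC: "(LINT t|M. ?T k t) \<le> C" for k
  proof (rule ccontr)
    assume "\<not> ?thesis"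
    then have "\<forall>\<^sub>F n in F. C < (LINT t|M. norm (fam n t) powr p)"
      using weak_limit_powr_truncated_less[OF M p a w fam, of C "real k"] by simp
    with C have "\<forall>\<^sub>F n in F. False" by eventually_elim simp
    then show False using F by simp
  qed
  have inc: "incseq (\<lambda>k. LINT t|M. ?T k t)"
    by (intro incseq_SucI integral_mono Ti) auto
  obtain L where L: "(\<lambda>k. LINT t|M. ?T k t) \<longlonglongrightarrow> L" "\<forall>k. (LINT t|M. ?T k t) \<le> L"
    using incseq_convergent[OF inc] TC by blast
  have mono: "AE t in M. mono (\<lambda>k. ?T k t)"
    by (intro AE_I2 incseq_SucI) auto
  have lim: "AE t in M. (\<lambda>k. ?T k t) \<longlonglongrightarrow> norm (a t) powr p"
    by (intro AE_I2 tendsto_truncated)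
  show "integrable M (\<lambda>t. norm (a t) powr p)"
    by (rule integrable_monotone_convergence[OF Ti mono lim L(1)]) measurable
  have "(LINT t|M. norm (a t) powr p) = L"
    by (rule integral_monotone_convergence[OF Ti mono lim L(1)]) measurable
  then show "(LINT t|M. norm (a t) powr p) \<le> C"
    using LIMSEQ_le_const2[OF L(1)] TC by auto
qed

section \<open>Weak compactness of the control ball\<close>

text \<open>The hypothesis \<open>ac\<close> gives continuity at the empty set, which upgrades
  finite to countable additivity, and it makes null sets of \<open>M\<close> null for the new
  measure; Radon-Nikodym then supplies the density. Finite total mass makes it real-valued almost
  everywhere.\<close>

lemma additive_set_function_density:
  fixes m :: "'a set \<Rightarrow> real"
  assumes M: "finite_measure M"
    and nonneg: "\<And>E. E \<in> sets M \<Longrightarrow> 0 \<le> m E"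
    and add: "\<And>E E'. E \<in> sets M \<Longrightarrow> E' \<in> sets M \<Longrightarrow> E \<inter> E' = {} \<Longrightarrow> m (E \<union> E') = m E + m E'"
    and ac: "\<And>e. e > 0 \<Longrightarrow> \<exists>d>0. \<forall>E\<in>sets M. measure M E < d \<longrightarrow> m E < e"
  obtains h where "integrable M h" "\<And>E. E \<in> sets M \<Longrightarrow> m E = (LINT x|M. indicator E x * h x)"
proof -
  interpret finite_measure M by fact
  have m0: "m {} = 0" using add[of "{}" "{}"] by simp
  let ?\<mu> = "\<lambda>E. ennreal (m E)"
  have pos: "positive (sets M) ?\<mu>" by (simp add: positive_def m0)
  have additive: "additive (sets M) ?\<mu>"
    unfolding additive_def using add nonneg by (simp add: ennreal_plus)
  have ca: "countably_additive (sets M) ?\<mu>"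
  proof (rule sets.empty_continuous_imp_countably_additive[OF pos additive])
    fix A :: "nat \<Rightarrow> 'a set" assume A: "range A \<subseteq> sets M" "decseq A" "(\<Inter>i. A i) = {}"
    have "(\<lambda>i. m (A i)) \<longlonglongrightarrow> 0"
    proof (rule LIMSEQ_I)
      fix e :: real assume "e > 0"
      then obtain d where d: "d > 0" "\<And>E. E \<in> sets M \<Longrightarrow> measure M E < d \<Longrightarrow> m E < e" using ac by blast
      have "(\<lambda>i. measure M (A i)) \<longlonglongrightarrow> 0" using finite_Lim_measure_decseq[OF A(1,2)] A(3) by simp
      then have "\<forall>\<^sub>F i in sequentially. measure M (A i) < d" using d(1) by (rule order_tendstoD)
      then obtain i0 where "\<And>i. i \<ge> i0 \<Longrightarrow> measure M (A i) < d" by (auto simp: eventually_sequentially)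
      then show "\<exists>i0. \<forall>i\<ge>i0. norm (m (A i) - 0) < e"
        using d(2) A(1) nonneg by (intro exI[of _ i0]) (auto simp: abs_of_nonneg subset_iff)
    qed
    then show "(\<lambda>i. ?\<mu> (A i)) \<longlonglongrightarrow> 0" using tendsto_ennrealI by fastforce
  qed auto
  define N where "N = measure_of (space M) (sets M) ?\<mu>"
  have sN: "sets N = sets M" and spN: "space N = space M" by (simp_all add: N_def)
  have eN: "emeasure N E = ?\<mu> E" if "E \<in> sets M" for E
    unfolding N_def by (rule emeasure_measure_of_sigma[OF sets.sigma_algebra_axioms pos ca that])
  have finN: "finite_measure N"
    by (rule finite_measureI) (simp add: spN eN)
  have "absolutely_continuous M N"
    unfolding absolutely_continuous_def
  proof
    fix E assume E: "E \<in> null_sets M"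
    have "m E \<le> 0 + e" if e: "e > 0" for e
    proof -
      obtain d where d: "d > 0" "\<And>E. E \<in> sets M \<Longrightarrow> measure M E < d \<Longrightarrow> m E < e" using ac[OF e] by blast
      moreover have "measure M E = 0" "E \<in> sets M" using E by (auto simp: null_sets_def measure_def)
      ultimately show ?thesis by fastforce
    qed
    then have "m E \<le> 0" by (rule field_le_epsilon)
    then show "E \<in> null_sets N" using E eN[of E] sN by (auto simp: null_sets_def ennreal_eq_0_iff)
  qed
  then obtain f where f[measurable]: "f \<in> borel_measurable M" and dens: "density M f = N"
    using Radon_Nikodym_finite_measure[OF finN sN] by blast
  have fE: "(\<integral>\<^sup>+x. f x * indicator E x \<partial>M) = ennreal (m E)" if "E \<in> sets M" for E
    using emeasure_density[OF f that] eN[OF that] dens by simp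
  have "(\<integral>\<^sup>+x. f x \<partial>M) = (\<integral>\<^sup>+x. f x * indicator (space M) x \<partial>M)"
    by (intro nn_integral_cong) simp
  also have "\<dots> \<noteq> \<infinity>" unfolding fE[OF sets.top] by simp
  finally have "AE x in M. f x \<noteq> \<infinity>" by (rule nn_integral_PInf_AE[OF f])
  then have fr: "AE x in M. ennreal (enn2real (f x)) = f x"
    by eventually_elim (simp add: less_top)
  have hE: "has_bochner_integral M (\<lambda>x. indicator E x * enn2real (f x)) (m E)" if E: "E \<in> sets M" for E
  proof (rule has_bochner_integral_nn_integral)
    show "(\<lambda>x. indicator E x * enn2real (f x)) \<in> borel_measurable M" using E by measurable
    show "(\<integral>\<^sup>+x. ennreal (indicator E x * enn2real (f x)) \<partial>M) = ennreal (m E)"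
      unfolding fE[OF E, symmetric]
      by (rule nn_integral_cong_AE) (use fr in \<open>eventually_elim, auto simp: indicator_def\<close>)
  qed (use nonneg[OF E] in auto)
  show thesis
  proof
    have "integrable M (\<lambda>x. indicator (space M) x * enn2real (f x))"
      using hE[of "space M"] by (auto intro: has_bochner_integral_integrable simp: has_bochner_integral_iff)
    moreover have "integrable M (\<lambda>x. indicator (space M) x * enn2real (f x)) \<longleftrightarrow> integrable M (\<lambda>x. enn2real (f x))"
      by (intro Bochner_Integration.integrable_cong) auto
    ultimately show "integrable M (\<lambda>x. enn2real (f x))" by simp
  qed (use hE in \<open>auto simp: has_bochner_integral_iff\<close>)
qed

text \<open>Convergence on measurable sets extends by linearity to step functions, and these
  approximate a bounded \<open>g\<close> uniformly. The common bound \<open>K\<close> makes the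
  approximation error uniform in \<open>n\<close>.\<close>

lemma tendsto_integral_bounded_mult:
  fixes u :: "'i \<Rightarrow> 'a \<Rightarrow> real"
  assumes u: "\<And>n. integrable M (u n)" "\<And>n. (LINT t|M. \<bar>u n t\<bar>) \<le> K" and v: "integrable M v"
    and g: "g \<in> borel_measurable M" "\<And>t. \<bar>g t\<bar> \<le> B"
    and lim: "\<And>E. E \<in> sets M \<Longrightarrow> ((\<lambda>n. LINT t|M. indicator E t * u n t) \<longlongrightarrow> (LINT t|M. indicator E t * v t)) F"
  shows "((\<lambda>n. LINT t|M. g t * u n t) \<longlongrightarrow> (LINT t|M. g t * v t)) F"
proof (rule tendstoI)
  fix e :: real assume e: "e > 0"
  have K: "0 \<le> K" using u(2)[of undefined] by (rule order_trans[rotated]) (rule Bochner_Integration.integral_nonneg, simp)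
  define V where "V = (LINT t|M. \<bar>v t\<bar>)"
  have V: "0 \<le> V" unfolding V_def by (rule Bochner_Integration.integral_nonneg) simp
  \<comment> \<open>The errors for \<open>u n\<close> and for \<open>v\<close> add up to at most
    \<open>d * (K + V)\<close>; the \<open>+ 1\<close> avoids division by zero.\<close>
  define d where "d = e / (2 * (K + V + 1))"
  have d: "d > 0" using e K V by (simp add: d_def)
  \<comment> \<open>\<open>E j\<close> is the set where the floor of \<open>g t / d\<close> is
    \<open>j\<close>; boundedness of \<open>g\<close> leaves only the finitely many \<open>j\<close>
    in \<open>J\<close>.\<close>
  define E where "E j = {t \<in> space M. real_of_int j \<le> g t / d \<and> g t / d < real_of_int j + 1}" for j
  have Es: "E j \<in> sets M" for j unfolding E_def using g(1) by measurable
  define J where "J = {- \<lceil>B / d\<rceil> - 1..\<lceil>B / d\<rceil>}"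
  define s where "s t = (\<Sum>j\<in>J. (d * real_of_int j) * indicator (E j) t)" for t
  have gs: "\<bar>g t - s t\<bar> \<le> d" if t: "t \<in> space M" for t
  proof -
    let ?k = "\<lfloor>g t / d\<rfloor>"
    have "g t / d \<le> B / d" "- (B / d) \<le> g t / d"
      using g(2)[of t] d by (auto simp: field_simps abs_le_iff)
    then have "real_of_int (- \<lceil>B / d\<rceil> - 1) \<le> real_of_int ?k" "real_of_int ?k \<le> real_of_int \<lceil>B / d\<rceil>"
      by linarith+
    then have "?k \<in> J" unfolding J_def of_int_le_iff by simp
    have Ek: "t \<in> E j \<longleftrightarrow> j = ?k" for j
      using t floor_unique[of j "g t / d"] by (auto simp: E_def)
    have "s t = (\<Sum>j\<in>J. if j = ?k then d * real_of_int ?k else 0)"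
      unfolding s_def by (intro sum.cong) (auto simp: Ek indicator_def)
    also have "\<dots> = d * real_of_int ?k" using \<open>?k \<in> J\<close> by (simp add: J_def)
    finally have "g t - s t = d * (g t / d - real_of_int ?k)" using d by (simp add: algebra_simps)
    moreover have "0 \<le> g t / d - real_of_int ?k" "g t / d - real_of_int ?k \<le> 1" by linarith+
    ultimately show ?thesis using d by (simp add: abs_mult mult_left_le)
  qed
  have int_E: "integrable M (\<lambda>t. indicator (E j) t * w t)" if "integrable M w" for w :: "'a \<Rightarrow> real" and j
    using integrable_mult_indicator[OF Es that] by simp
  have s_eq: "(LINT t|M. s t * w t) = (\<Sum>j\<in>J. (d * real_of_int j) * (LINT t|M. indicator (E j) t * w t))"
    and s_int: "integrable M (\<lambda>t. s t * w t)" if w: "integrable M w" for w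
  proof -
    have *: "s t * w t = (\<Sum>j\<in>J. (d * real_of_int j) * (indicator (E j) t * w t))" for t
      by (simp add: s_def sum_distrib_right mult.assoc)
    show "(LINT t|M. s t * w t) = (\<Sum>j\<in>J. (d * real_of_int j) * (LINT t|M. indicator (E j) t * w t))"
      unfolding * using int_E[OF w] by (subst Bochner_Integration.integral_sum) auto
    show "integrable M (\<lambda>t. s t * w t)"
      unfolding * using int_E[OF w] by (intro Bochner_Integration.integrable_sum integrable_mult_right)
  qed
  have approx: "\<bar>(LINT t|M. g t * w t) - (LINT t|M. s t * w t)\<bar> \<le> d * (LINT t|M. \<bar>w t\<bar>)"
    if w: "integrable M w" for w
  proof -
    have gw: "integrable M (\<lambda>t. g t * w t)"
      using integrable_bounded_inner[of M w g B] w g by simp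
    have "\<bar>(LINT t|M. g t * w t) - (LINT t|M. s t * w t)\<bar> = \<bar>LINT t|M. (g t - s t) * w t\<bar>"
      using gw s_int[OF w] by (simp add: left_diff_distrib)
    also have "\<dots> \<le> (LINT t|M. \<bar>(g t - s t) * w t\<bar>)" by (rule integral_abs_bound)
    also have "\<dots> \<le> (LINT t|M. d * \<bar>w t\<bar>)"
    proof (rule integral_mono_AE')
      show "integrable M (\<lambda>t. d * \<bar>w t\<bar>)" using w by simp
      show "AE t in M. \<bar>(g t - s t) * w t\<bar> \<le> d * \<bar>w t\<bar>"
        using gs by (intro AE_I2) (simp add: abs_mult mult_right_mono)
    qed (use d in auto)
    finally show ?thesis by simp
  qed
  have "((\<lambda>n. LINT t|M. s t * u n t) \<longlongrightarrow> (LINT t|M. s t * v t)) F"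
    unfolding s_eq[OF u(1)] s_eq[OF v] by (intro tendsto_intros lim Es)
  then have "\<forall>\<^sub>F n in F. dist (LINT t|M. s t * u n t) (LINT t|M. s t * v t) < e / 2"
    by (rule tendstoD) (use e in simp)
  then show "\<forall>\<^sub>F n in F. dist (LINT t|M. g t * u n t) (LINT t|M. g t * v t) < e"
  proof eventually_elim
    case (elim n)
    have "d * (LINT t|M. \<bar>u n t\<bar>) + d * V \<le> d * (K + V + 1)"
      using d u(2)[of n] by (simp add: distrib_left[symmetric])
    also have "\<dots> = e / 2" using K V by (simp add: d_def field_simps)
    finally show ?case
      using elim approx[OF u(1), of n] approx[OF v] unfolding dist_real_def V_def by linarith
  qed
qed

text \<open>A cluster point need not be reached along a subsequence. It is reached along the
  refinement of \<open>F\<close> by the preimages of its neighbourhoods, and being a cluster point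
  says exactly that this refinement is a proper filter.\<close>

lemma filterlim_cluster_point:
  assumes U: "compact U" and X: "\<And>n. X n \<in> U" and F: "F \<noteq> bot"
  obtains G x where "G \<le> F" "G \<noteq> bot" "x \<in> U" "(X \<longlongrightarrow> x) G"
proof -
  have "filtermap X F \<noteq> bot" using F by (simp add: filtermap_bot_iff)
  moreover have "\<forall>\<^sub>F x in filtermap X F. x \<in> U" using X by (simp add: eventually_filtermap)
  ultimately obtain x where x: "x \<in> U" "inf (nhds x) (filtermap X F) \<noteq> bot"
    using U unfolding compact_filter by blast
  define G where "G = inf F (filtercomap X (nhds x))"
  show thesis
  proof
    show "G \<le> F" by (simp add: G_def)
    show "(X \<longlongrightarrow> x) G"
      unfolding G_def by (rule filterlim_mono[OF filterlim_filtercomap]) auto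
    show "G \<noteq> bot"
    proof
      assume "G = bot"
      then have "\<forall>\<^sub>F n in G. False" by simp
      then obtain P Q where P: "eventually P F" and Q: "eventually Q (filtercomap X (nhds x))"
        and PQ: "\<And>n. P n \<Longrightarrow> Q n \<Longrightarrow> False"
        unfolding G_def eventually_inf by blast
      obtain R where R: "eventually R (nhds x)" "\<And>n. R (X n) \<Longrightarrow> Q n"
        using Q unfolding eventually_filtercomap by blast
      have "eventually (\<lambda>y. \<exists>n. P n \<and> y = X n) (filtermap X F)"
        unfolding eventually_filtermap using P by (rule eventually_mono) auto
      then have "eventually (\<lambda>y. False) (inf (nhds x) (filtermap X F))"
        unfolding eventually_inf using R PQ by blast
      then show False using x(2) by simp
    qed
  qed (rule x(1))
qed

text \<open>Tychonoff provides a filter along which the integrals of the positive and negative parts of all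
  coordinates over all measurable sets converge simultaneously; by uniform integrability the limits are
  absolutely continuous measures, and their densities assemble the weak limit.\<close>
lemma control_ball_weakly_compact:
  fixes fam :: "nat \<Rightarrow> real \<Rightarrow> real ^ 'd::finite"
  assumes p: "1 < p" and c: "0 < c" and fam: "\<And>n. fam n \<in> control_ball p c"
  obtains G a where "G \<le> sequentially" "G \<noteq> bot" "a \<in> control_ball p c"
    "bounded_weak_tendsto (lebesgue_on {0..1}) fam a G"
proof -
  let ?M = "lebesgue_on {0..1::real}"
  have M: "finite_measure ?M" by (simp add: finite_measure_lebesgue_on)
  have famL: "fam n \<in> Lp_space p" and famc: "Lp_norm p (fam n) \<le> c" for n
    using fam by (auto simp: control_ball_def)
  have fi: "integrable ?M (fam n)" for n by (rule Lp_space_integrable[OF famL p])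
  \<comment> \<open>Positive and negative parts keep the limiting set functions nonnegative, so that
    they are measures. Their limits need not be the two parts of the weak limit, but only the
    difference matters.\<close>
  define part where "part s x = max 0 (if s then x else - x)" for s and x :: real
  have part: "0 \<le> part s x" "part s x \<le> \<bar>x\<bar>" "x = part True x - part False x" for s x
    by (auto simp: part_def)
  have parti: "integrable ?M (\<lambda>t. part s (fam n t $ i))" for s n i
  proof (rule Bochner_Integration.integrable_bound[OF integrable_vec_nth[OF fi]])
    have "(\<lambda>t. fam n t $ i) \<in> borel_measurable ?M" using integrable_vec_nth[OF fi] by auto
    then show "(\<lambda>t. part s (fam n t $ i)) \<in> borel_measurable ?M" unfolding part_def by measurable
    show "AE t in ?M. norm (part s (fam n t $ i)) \<le> norm (fam n t $ i)" using part(1,2) by simp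
  qed
  have partE: "integrable ?M (\<lambda>t. indicator E t * part s (fam n t $ i))" if "E \<in> sets ?M" for E s n i
    using integrable_mult_indicator[OF that parti] by simp
  \<comment> \<open>The value 0 on nonmeasurable \<open>E\<close> makes \<open>\<Psi> n\<close> a
    point of a product over the whole index type.\<close>
  define \<Psi> where "\<Psi> n k = (case k of (E, i, s) \<Rightarrow>
      if E \<in> sets ?M then LINT t|?M. indicator E t * part s (fam n t $ i) else 0)" for n k
  have \<Psi>_nonneg: "0 \<le> \<Psi> n k" for n k
    by (auto simp: \<Psi>_def part intro!: Bochner_Integration.integral_nonneg split: prod.split)
  have \<Psi>_le: "\<Psi> n (E, i, s) \<le> l * measure ?M E + l powr (1 - p) * c powr p"
    if E: "E \<in> sets ?M" and l: "l > 0" for n E i s l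
  proof -
    have "\<Psi> n (E, i, s) = (LINT t|?M. indicator E t * part s (fam n t $ i))" using E by (simp add: \<Psi>_def)
    also have "\<dots> \<le> (LINT t|?M. indicator E t * norm (fam n t))"
    proof (rule integral_mono[OF partE[OF E]])
      show "integrable ?M (\<lambda>t. indicator E t * norm (fam n t))"
        using integrable_mult_indicator[OF E integrable_norm[OF fi]] by simp
      show "indicator E t * part s (fam n t $ i) \<le> indicator E t * norm (fam n t)" for t
        using part(2)[of s "fam n t $ i"] component_le_norm_cart[of "fam n t" i] by (auto simp: indicator_def)
    qed
    also have "\<dots> \<le> l * measure ?M E + l powr (1 - p) * Lp_norm p (fam n) powr p"
      by (rule Lp_equiintegrable[OF famL p l E])
    also have "\<dots> \<le> l * measure ?M E + l powr (1 - p) * c powr p"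
      using famc p by (intro add_left_mono mult_left_mono powr_mono2) (auto simp: Lp_norm_def)
    finally show ?thesis .
  qed
  \<comment> \<open>The bound \<open>\<Psi>_le\<close> with \<open>l = 1\<close>, as the unit
    interval has measure 1.\<close>
  define K where "K = 1 + c powr p"
  have mle1: "measure ?M E \<le> 1" for E
    using finite_measure.bounded_measure[OF M, of E] by (simp add: measure_restrict_space)
  have \<Psi>_K: "\<Psi> n k \<in> {0..K}" for n k
  proof -
    obtain E i s where k: "k = (E, i, s)" by (cases k)
    show ?thesis
    proof (cases "E \<in> sets ?M")
      case True
      then show ?thesis
        using \<Psi>_le[OF True, of 1 n i s] mle1[of E] \<Psi>_nonneg[of n k] by (simp add: k K_def)
    next
      case False
      then show ?thesis by (simp add: k \<Psi>_def K_def)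
    qed
  qed
  have "compact (PiE UNIV (\<lambda>k :: real set \<times> 'd \<times> bool. {0..K}))"
    using compactin_PiE[of "\<lambda>k :: real set \<times> 'd \<times> bool. euclideanreal" UNIV "\<lambda>k. {0..K}"]
    by (simp add: euclidean_product_topology)
  then obtain G \<nu> where G: "G \<le> sequentially" "G \<noteq> bot" "(\<Psi> \<longlongrightarrow> \<nu>) G"
    by (rule filterlim_cluster_point[where X = \<Psi> and F = sequentially]) (use \<Psi>_K in auto)
  have lim: "((\<lambda>n. \<Psi> n k) \<longlongrightarrow> \<nu> k) G" for k
  proof -
    show ?thesis
      by (rule continuous_on_tendsto_compose[OF continuous_on_product_coordinates G(3)]) auto
  qed
  have \<nu>_le: "\<nu> (E, i, s) \<le> l * measure ?M E + l powr (1 - p) * c powr p"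
    if E: "E \<in> sets ?M" and l: "l > 0" for E i s l
    by (rule tendsto_upperbound[OF lim _ G(2)]) (use \<Psi>_le[OF E l] in auto)
  have "\<exists>h. integrable ?M h \<and> (\<forall>E\<in>sets ?M. \<nu> (E, i, s) = (LINT t|?M. indicator E t * h t))" for i s
  proof (rule additive_set_function_density[OF M, of "\<lambda>E. \<nu> (E, i, s)"])
    show "0 \<le> \<nu> (E, i, s)" for E
      by (rule tendsto_lowerbound[OF lim _ G(2)]) (use \<Psi>_nonneg in auto)
  next
    fix E E' assume E: "E \<in> sets ?M" "E' \<in> sets ?M" "E \<inter> E' = {}"
    have "\<Psi> n (E \<union> E', i, s) = \<Psi> n (E, i, s) + \<Psi> n (E', i, s)" for n
    proof -
      have "(\<lambda>t. indicator (E \<union> E') t * part s (fam n t $ i)) =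
          (\<lambda>t. indicator E t * part s (fam n t $ i) + indicator E' t * part s (fam n t $ i))"
        using E(3) by (intro ext) (auto split: split_indicator)
      then show ?thesis using E partE by (simp add: \<Psi>_def)
    qed
    then have "((\<lambda>n. \<Psi> n (E \<union> E', i, s)) \<longlongrightarrow> \<nu> (E, i, s) + \<nu> (E', i, s)) G"
      by (simp add: tendsto_add lim)
    then show "\<nu> (E \<union> E', i, s) = \<nu> (E, i, s) + \<nu> (E', i, s)"
      using tendsto_unique[OF G(2) lim] by blast
  next
    fix e :: real assume e: "e > 0"
    have "((\<lambda>l. l powr (1 - p) * c powr p) \<longlongrightarrow> 0 * c powr p) at_top"
      using p by (intro tendsto_intros tendsto_neg_powr filterlim_ident) auto
    then have "\<forall>\<^sub>F l in at_top. l powr (1 - p) * c powr p < e / 2"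
      by (rule order_tendstoD) (use e in auto)
    then have "\<forall>\<^sub>F l in at_top. l powr (1 - p) * c powr p < e / 2 \<and> l > 0"
      using eventually_gt_at_top[of 0] by eventually_elim simp
    then obtain l where l: "l powr (1 - p) * c powr p < e / 2" "l > 0"
      by (metis (mono_tags, lifting) eventually_at_top_linorder order_refl)
    show "\<exists>d>0. \<forall>E\<in>sets ?M. measure ?M E < d \<longrightarrow> \<nu> (E, i, s) < e"
    proof (intro exI conjI ballI impI)
      show "e / (2 * l) > 0" using e l by simp
      fix E assume E: "E \<in> sets ?M" "measure ?M E < e / (2 * l)"
      have "l * measure ?M E < e / 2" using E(2) l(2) by (simp add: field_simps)
      then show "\<nu> (E, i, s) < e" using \<nu>_le[OF E(1) l(2), of i s] l(1) by linarith
    qed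
  qed blast
  then obtain h where hi: "\<And>i s. integrable ?M (h i s)"
    and h: "\<And>i s E. E \<in> sets ?M \<Longrightarrow> \<nu> (E, i, s) = (LINT t|?M. indicator E t * h i s t)"
    by metis
  define a where "a t = (\<chi> i. h i True t - h i False t)" for t
  have ai: "integrable ?M a"
    by (rule integrable_vecI) (simp add: a_def hi)
  have conv: "((\<lambda>n. LINT t|?M. indicator E t * (fam n t $ i)) \<longlongrightarrow> (LINT t|?M. indicator E t * (a t $ i))) G"
    if E: "E \<in> sets ?M" for E i
  proof -
    have "(LINT t|?M. indicator E t * (fam n t $ i)) = \<Psi> n (E, i, True) - \<Psi> n (E, i, False)" for n
    proof -
      have "indicator E t * (fam n t $ i) =
          indicator E t * part True (fam n t $ i) - indicator E t * part False (fam n t $ i)" for t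
        using part(3)[of "fam n t $ i"] by (simp flip: right_diff_distrib)
      then show ?thesis using E partE by (simp add: \<Psi>_def)
    qed
    moreover have "(LINT t|?M. indicator E t * (a t $ i)) = \<nu> (E, i, True) - \<nu> (E, i, False)"
    proof -
      have "integrable ?M (\<lambda>t. indicator E t * h i s t)" for s
        using integrable_mult_indicator[OF E hi] by simp
      then show ?thesis by (simp add: a_def right_diff_distrib h[OF E])
    qed
    ultimately show ?thesis by (simp add: tendsto_diff lim)
  qed
  have w: "bounded_weak_tendsto ?M fam a G"
    unfolding bounded_weak_tendsto_def
  proof (intro ballI allI impI)
    fix g :: "real \<Rightarrow> real ^ 'd" and B
    assume g: "g \<in> borel_measurable ?M" and B: "\<forall>t. norm (g t) \<le> B"
    have gi: "(\<lambda>t. g t $ i) \<in> borel_measurable ?M" for i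
      using g by (rule measurable_compose) (intro borel_measurable_continuous_onI continuous_intros)
    have gB: "\<bar>g t $ i\<bar> \<le> B" for t i using component_le_norm_cart[of "g t" i] B order_trans by blast
    have gint: "integrable ?M (\<lambda>t. g t $ i * b t $ i)" if "integrable ?M b" for b :: "real \<Rightarrow> real ^ 'd" and i
      using integrable_bounded_inner[OF integrable_vec_nth[OF that], of "\<lambda>t. g t $ i" B] gi gB by simp
    have "((\<lambda>n. LINT t|?M. g t $ i * fam n t $ i) \<longlongrightarrow> (LINT t|?M. g t $ i * a t $ i)) G" for i
    proof (rule tendsto_integral_bounded_mult[OF integrable_vec_nth[OF fi] _ integrable_vec_nth[OF ai] gi gB conv])
      fix n
      have "(LINT t|?M. \<bar>fam n t $ i\<bar>) \<le> (LINT t|?M. norm (fam n t))"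
        using integrable_vec_nth[OF fi] fi by (intro integral_mono integrable_norm component_le_norm_cart) auto
      also have "\<dots> \<le> 2 * c" using Lp_norm_ge_L1[OF famL p, of n] famc[of n] by simp
      finally show "(LINT t|?M. \<bar>fam n t $ i\<bar>) \<le> 2 * c" .
    qed
    then have "((\<lambda>n. \<Sum>i\<in>UNIV. LINT t|?M. g t $ i * fam n t $ i) \<longlongrightarrow> (\<Sum>i\<in>UNIV. LINT t|?M. g t $ i * a t $ i)) G"
      by (intro tendsto_sum)
    then show "((\<lambda>n. LINT t|?M. g t \<bullet> fam n t) \<longlongrightarrow> (LINT t|?M. g t \<bullet> a t)) G"
      using gint[OF fi] gint[OF ai] by (simp add: inner_vec_def Bochner_Integration.integral_sum)
  qed
  have famp: "\<forall>\<^sub>F n in G. integrable ?M (fam n) \<and> integrable ?M (\<lambda>t. norm (fam n t) powr p)"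
    using fi Lp_spaceD(2)[OF famL] by simp
  have "\<forall>\<^sub>F n in G. (LINT t|?M. norm (fam n t) powr p) \<le> c powr p"
  proof (intro always_eventually allI)
    fix n
    have "Lp_norm p (fam n) powr p \<le> c powr p" using famc p by (intro powr_mono2) (auto simp: Lp_norm_def)
    then show "(LINT t|?M. norm (fam n t) powr p) \<le> c powr p" using p by (simp add: Lp_norm_powr)
  qed
  \<comment> \<open>Lower semicontinuity shows that the ball is weakly closed; up to here
    \<open>a\<close> is only known to be integrable.\<close>
  note ap = weak_limit_powr_le[OF M p ai G(2) w famp this]
  have "Lp_norm p a \<le> (c powr p) powr (1 / p)"
    unfolding Lp_norm_def using ap(2) p by (intro powr_mono2) (auto intro: Bochner_Integration.integral_nonneg)
  also have "\<dots> = c" using p c by (simp add: powr_powr)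
  finally have "a \<in> control_ball p c"
    using ap(1) ai by (auto simp: control_ball_def Lp_space_def)
  then show thesis using that G(1,2) w by blast
qed

section \<open>The penalized functionals\<close>

lemma Lp_norm_powr_less_weak_limit:
  assumes p: "1 < p" and a: "a \<in> Lp_space p"
    and w: "bounded_weak_tendsto (lebesgue_on {0..1}) fam a F"
    and fam: "\<forall>\<^sub>F n in F. fam n \<in> control_ball p c"
    and y: "y < Lp_norm p a powr p"
  shows "\<forall>\<^sub>F n in F. y < Lp_norm p (fam n) powr p"
proof -
  have "\<forall>\<^sub>F n in F. integrable (lebesgue_on {0..1}) (fam n) \<and>
      integrable (lebesgue_on {0..1}) (\<lambda>t. norm (fam n t) powr p)"
    using fam by eventually_elim (auto simp: control_ball_def Lp_space_integrable[OF _ p] Lp_spaceD)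
  then show ?thesis
    using weak_limit_powr_less[OF _ p Lp_space_integrable[OF a p] Lp_spaceD(2)[OF a] w] y p
    by (simp add: Lp_norm_powr finite_measure_lebesgue_on)
qed

lemma tendsto_endpoint_penalty:
  fixes f :: "('d::finite, 'n::finite) trunc_tensor \<times> ('d, 'n) trunc_tensor \<Rightarrow> real"
  assumes p: "1 < p" and c: "0 < c"
    and gbar: "gbar \<in> signature_space" and f: "continuous_on (signature_space \<times> signature_space) f"
    and a: "a \<in> Lp_space p" and fam: "\<forall>\<^sub>F n in F. fam n \<in> control_ball p c"
    and w: "bounded_weak_tendsto (lebesgue_on {0..1}) fam a F"
  shows "((\<lambda>n. f (signature_curve (fam n) 1, gbar)) \<longlongrightarrow> f (signature_curve a 1, gbar)) F"
proof (rule continuous_on_tendsto_compose[OF f])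
  show "((\<lambda>n. (signature_curve (fam n) 1 :: ('d, 'n) trunc_tensor, gbar)) \<longlongrightarrow> (signature_curve a 1, gbar)) F"
    by (intro tendsto_Pair tendsto_const tendsto_signature_curve[OF p c fam a w])
  show "(signature_curve a 1 :: ('d, 'n) trunc_tensor, gbar) \<in> signature_space \<times> signature_space"
    using signature_curve_in_signature_space[OF a p, where 'n='n] gbar by simp
  show "\<forall>\<^sub>F n in F. (signature_curve (fam n) 1 :: ('d, 'n) trunc_tensor, gbar) \<in> signature_space \<times> signature_space"
    using fam by eventually_elim (simp add: control_ball_def signature_curve_in_signature_space[OF _ p] gbar)
qed

theorem theorem3p2:
  fixes p c :: real
    and gbar :: "('d::finite, 'n::finite) trunc_tensor"
    and f :: "('d, 'n) trunc_tensor \<times> ('d, 'n) trunc_tensor \<Rightarrow> real"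
  assumes "1 < p"
    and "gbar \<in> signature_space"
    and "continuous_on (signature_space \<times> signature_space) f"
    and "\<forall>z \<in> signature_space \<times> signature_space. 0 \<le> f z"
    and "f (gbar, gbar) = 0"
    and "\<forall>g \<in> signature_space. g \<noteq> gbar \<longrightarrow> 0 < f (g, gbar)"
    and "0 < c"
  shows "(\<forall>\<gamma>>0. \<exists>a \<in> control_ball p c. \<forall>b \<in> control_ball p c.
            penalized_energy p f gbar \<gamma> a \<le> penalized_energy p f gbar \<gamma> b) \<and>
         Gamma_converges_on (control_ball p c)
           (\<lambda>fam a. Lp_weak_tendsto p fam a at_top)
           (\<lambda>\<gamma> a. ereal (penalized_energy p f gbar \<gamma> a))
           (constrained_energy p gbar)"
proof (intro conjI allI impI)
  note p = assms(1) and gbar = assms(2) and c = assms(7)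
  have ballD: "a \<in> Lp_space p" if "a \<in> control_ball p c" for a :: "real \<Rightarrow> real ^ 'd"
    using that by (simp add: control_ball_def)
  have sig: "(signature_curve a 1 :: ('d, 'n) trunc_tensor) \<in> signature_space"
    if "a \<in> control_ball p c" for a :: "real \<Rightarrow> real ^ 'd"
    by (rule signature_curve_in_signature_space[OF ballD[OF that] p])
  have f_nonneg: "0 \<le> f (signature_curve a 1, gbar)" if "a \<in> control_ball p c" for a
    using assms(4) sig[OF that] gbar by simp
  note pen = tendsto_endpoint_penalty[OF p c gbar assms(3) ballD]
  {
    fix \<gamma> :: real assume \<gamma>: "0 < \<gamma>"
    let ?J = "penalized_energy p f gbar \<gamma>"
    let ?A = "control_ball p c :: (real \<Rightarrow> real ^ 'd) set"
    have J_nonneg: "0 \<le> ?J b" if "b \<in> ?A" for b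
      using \<gamma> f_nonneg[OF that] by (simp add: penalized_energy_def)
    have "(\<lambda>t. 0) \<in> ?A"
      using p c by (simp add: control_ball_def Lp_space_def Lp_norm_def)
    then have ne: "?J ` ?A \<noteq> {}" by blast
    have bdd: "bdd_below (?J ` ?A)" using J_nonneg by (auto intro: bdd_belowI[of _ 0])
    define m where "m = Inf (?J ` ?A)"
    have "\<exists>b\<in>?A. ?J b < m + 1 / (real n + 1)" for n
      using cInf_lessD[OF ne, of "m + 1 / (real n + 1)"] by (auto simp: m_def)
    then obtain fam where fam: "\<And>n. fam n \<in> ?A" "\<And>n. ?J (fam n) < m + 1 / (real n + 1)"
      by metis
    obtain G a where G: "G \<le> sequentially" "G \<noteq> bot" and a: "a \<in> ?A"
      and w: "bounded_weak_tendsto (lebesgue_on {0..1}) fam a G"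
      by (rule control_ball_weakly_compact[OF p c fam(1)])
    have famG: "\<forall>\<^sub>F n in G. fam n \<in> ?A" using fam(1) by simp
    \<comment> \<open>Three errors of \<open>e / 3\<close> along \<open>G\<close>: the excess of
      \<open>fam n\<close> over the infimum, the loss in lower semicontinuity of the norm, and the
      change of the penalty.\<close>
    have "?J a \<le> m + e" if e: "e > 0" for e
    proof -
      have "(\<lambda>n. 1 / (real n + 1)) \<longlonglongrightarrow> 0"
        using LIMSEQ_inverse_real_of_nat by (simp add: inverse_eq_divide add.commute)
      then have "\<forall>\<^sub>F n in sequentially. 1 / (real n + 1) < e / 3"
        by (rule order_tendstoD) (use e in simp)
      then have "\<forall>\<^sub>F n in G. 1 / (real n + 1) < e / 3" by (rule filter_leD[OF G(1)])
      moreover have "\<forall>\<^sub>F n in G. Lp_norm p a powr p - e / 3 < Lp_norm p (fam n) powr p"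
        by (rule Lp_norm_powr_less_weak_limit[OF p ballD[OF a] w famG]) (use e in simp)
      moreover have "\<forall>\<^sub>F n in G. \<gamma> * f (signature_curve a 1, gbar) - e / 3 < \<gamma> * f (signature_curve (fam n) 1, gbar)"
        by (rule order_tendstoD(1)[OF tendsto_mult_left[OF pen[OF a famG w]]]) (use e in simp)
      ultimately have "\<forall>\<^sub>F n in G. ?J a \<le> m + e"
      proof eventually_elim
        case (elim n)
        then show ?case using fam(2)[of n] unfolding penalized_energy_def by linarith
      qed
      then show ?thesis using G(2) by simp
    qed
    then have "?J a \<le> m" by (rule field_le_epsilon)
    then show "\<exists>a\<in>?A. \<forall>b\<in>?A. ?J a \<le> ?J b"
      using a cInf_lower[OF _ bdd] unfolding m_def by (meson imageI order_trans)
  }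
  show "Gamma_converges_on (control_ball p c)
           (\<lambda>fam a. Lp_weak_tendsto p fam a at_top)
           (\<lambda>\<gamma> a. ereal (penalized_energy p f gbar \<gamma> a))
           (constrained_energy p gbar)"
    unfolding Gamma_converges_on_def
  proof (intro conjI ballI allI impI)
    fix a :: "real \<Rightarrow> real ^ 'd" and fam :: "real \<Rightarrow> real \<Rightarrow> real ^ 'd"
    assume a: "a \<in> control_ball p c" and fam: "\<forall>\<gamma>>0. fam \<gamma> \<in> control_ball p c"
      and "Lp_weak_tendsto p fam a at_top"
    then have w: "bounded_weak_tendsto (lebesgue_on {0..1}) fam a at_top"
      using Lp_weak_tendsto_imp_bounded[OF p] by blast
    have pos: "\<forall>\<^sub>F \<gamma> in at_top. \<gamma> > (0::real)" by (rule eventually_gt_at_top)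
    have famF: "\<forall>\<^sub>F \<gamma> in at_top. fam \<gamma> \<in> control_ball p c"
      using pos by eventually_elim (use fam in blast)
    \<comment> \<open>Real levels \<open>y\<close> below the limit treat its finite and its infinite
      value by one statement.\<close>
    have real_case: "\<forall>\<^sub>F \<gamma> in at_top. y < penalized_energy p f gbar \<gamma> (fam \<gamma>)"
      if y: "ereal y < constrained_energy p gbar a" for y
    proof (cases "signature_curve a 1 = gbar")
      case True
      then have "y < Lp_norm p a powr p" using y by (simp add: constrained_energy_def)
      then have "\<forall>\<^sub>F \<gamma> in at_top. y < Lp_norm p (fam \<gamma>) powr p"
        by (rule Lp_norm_powr_less_weak_limit[OF p ballD[OF a] w famF])
      then show ?thesis
        using pos famF
      proof eventually_elim
        case (elim \<gamma>)
        have "0 \<le> \<gamma> * f (signature_curve (fam \<gamma>) 1, gbar)" using f_nonneg[OF elim(3)] elim(2) by simp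
        then show ?case using elim(1) unfolding penalized_energy_def by linarith
      qed
    next
      case False
      define L where "L = f (signature_curve a 1, gbar)"
      have L: "L > 0" unfolding L_def using assms(6) sig[OF a] False by simp
      \<comment> \<open>The values of \<open>f\<close> converge to \<open>L > 0\<close>, so they
        eventually exceed \<open>L / 2\<close>; for \<open>\<gamma>\<close> beyond
        \<open>2 * \<bar>y\<bar> / L\<close> the energy is then above \<open>y\<close>.\<close>
      have "\<forall>\<^sub>F \<gamma> in at_top. L / 2 < f (signature_curve (fam \<gamma>) 1, gbar)"
        by (rule order_tendstoD(1)[OF pen[OF a famF w]]) (use L in \<open>simp add: L_def\<close>)
      then show ?thesis
        using eventually_gt_at_top[of "2 * \<bar>y\<bar> / L"] pos
      proof eventually_elim
        case (elim \<gamma>)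
        have "y \<le> \<bar>y\<bar>" by simp
        also have "\<dots> < \<gamma> * (L / 2)" using elim(2) L by (simp add: field_simps)
        also have "\<dots> \<le> \<gamma> * f (signature_curve (fam \<gamma>) 1, gbar)" using elim by (intro mult_left_mono) auto
        also have "\<dots> \<le> penalized_energy p f gbar \<gamma> (fam \<gamma>)" by (simp add: penalized_energy_def)
        finally show ?case .
      qed
    qed
    show "constrained_energy p gbar a \<le> Liminf at_top (\<lambda>\<gamma>. ereal (penalized_energy p f gbar \<gamma> (fam \<gamma>)))"
      unfolding le_Liminf_iff
    proof (intro allI impI)
      fix z :: ereal assume z: "z < constrained_energy p gbar a"
      show "\<forall>\<^sub>F \<gamma> in at_top. z < ereal (penalized_energy p f gbar \<gamma> (fam \<gamma>))"
        using z real_case by (cases z) auto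
    qed
  next
    fix a :: "real \<Rightarrow> real ^ 'd" assume a: "a \<in> control_ball p c"
    show "\<exists>fam. (\<forall>\<gamma>>0. fam \<gamma> \<in> control_ball p c) \<and> Lp_weak_tendsto p fam a at_top \<and>
        Limsup at_top (\<lambda>\<gamma>. ereal (penalized_energy p f gbar \<gamma> (fam \<gamma>))) \<le> constrained_energy p gbar a"
    proof (intro exI conjI allI impI)
      show "Lp_weak_tendsto p (\<lambda>\<gamma>. a) a at_top" by (simp add: Lp_weak_tendsto_def)
      \<comment> \<open>Off the target the right-hand side is infinite; on it the penalty vanishes
        for every \<open>\<gamma>\<close>, because \<open>f (gbar, gbar) = 0\<close>.\<close>
      show "Limsup at_top (\<lambda>\<gamma>. ereal (penalized_energy p f gbar \<gamma> a)) \<le> constrained_energy p gbar a"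
        by (simp add: constrained_energy_def penalized_energy_def assms(5) Limsup_const)
    qed (rule a)
  qed
qed

end
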